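(* Let $\nu\in\mathcal N$ and let $N\in\mathcal N$, $N\ne0$, satisfy $P_m^{(a)}(\nu,N)\ge0$ for all $(a,m)\in H'(N)$. Then the number of off-diagonal solutions to the string center equation of pattern $N$, divided by $\prod_{(a,m)\in H'(N)}N_m^{(a)}!$, is equal to $R(\nu,N)$.
   Context: Let $X_n$ be a finite-dimensional simple Lie algebra over $\mathbb{C}$ of rank $n$ with simple roots $\alpha_1,\dots,\alpha_n$; $(\cdot|\cdot)$ is the standard bilinear form with $(\alpha|\alpha)=2$ for long roots; $t_a=2/(\alpha_a|\alpha_a)\in\{1,2,3\}$. $H=\{(a,m)\mid 1\le a\le n,\ m\in\{1,2,\dots\}\}$; $\mathcal N$ is the set of families $N=(N_m^{(a)})_{(a,m)\in H}$ of nonnegative integers with finitely many nonzero entries. For $\nu,N\in\mathcal N$: $H'=H'(N)=\{(a,m)\in H\mid N_m^{(a)}>0\}$, $\gamma_m^{(a)}=\sum_{k\ge1}\min(m,k)\nu_k^{(a)}$, $P_m^{(a)}=P_m^{(a)}(\nu,N)=\gamma_m^{(a)}-\sum_{(b,k)\in H}(\alpha_a|\alpha_b)\min(t_bm,t_ak)N_k^{(b)}$, $F_{am,bk}=\delta_{ab}\delta_{mk}P_m^{(a)}+(\alpha_a|\alpha_b)\min(t_bm,t_ak)N_k^{(b)}$. Binomials: $\binom kj=k(k-1)\cdots(k-j+1)/j!$ if $j>0$, $1$ if $j=0$, $0$ if $j<0$. For $N\ne0$, $$R(\nu,N)=\Bigl(\det_{(a,m),(b,k)\in H'}F_{am,bk}\Bigr)\prod_{(a,m)\in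 H'}\frac1{N_m^{(a)}}\binom{P_m^{(a)}+N_m^{(a)}-1}{N_m^{(a)}-1}.$$ String center equation of pattern $N$: for nonzero complex unknowns $(z_{m\alpha}^{(a)})$ indexed by $(a,m)\in H'$, $1\le\alpha\le N_m^{(a)}$, $$\prod_{(b,k)\in H'}\prod_{\beta=1}^{N_k^{(b)}}(z_{k\beta}^{(b)})^{A_{am\alpha,bk\beta}}=(-1)^{P_m^{(a)}+N_m^{(a)}+1}\quad\text{for all }(a,m,\alpha),$$ with $A_{am\alpha,bk\beta}=\delta_{ab}\delta_{mk}\delta_{\alpha\beta}(P_m^{(a)}+N_m^{(a)})+(\alpha_a|\alpha_b)\min(t_bm,t_ak)-\delta_{ab}\delta_{mk}$. A solution $(z_{m\alpha}^{(a)})$ is off-diagonal if $z_{m\alpha}^{(a)}=z_{m\beta}^{(a)}$ only for $\alpha=\beta$ (for each $(a,m)\in H'$). *)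

theory Defs
  imports Complex_Main "HOL-Library.FuncSet" "HOL-Combinatorics.Permutations"
begin

section \<open>Simple complex Lie algebras, roots and the standard form\<close>

locale lie_algebra = vector_space scale
  for scale :: "complex \<Rightarrow> 'g::ab_group_add \<Rightarrow> 'g" +
  fixes br :: "'g \<Rightarrow> 'g \<Rightarrow> 'g"
  assumes br_linear_left: "Vector_Spaces.linear scale scale (\<lambda>x. br x y)"
    and br_linear_right: "Vector_Spaces.linear scale scale (br x)"
    and br_alternating: "br x x = 0"
    and jacobi: "br x (br y z) + br y (br z x) + br z (br x y) = 0"
begin

definition lie_ideal :: "'g set \<Rightarrow> bool" where
  "lie_ideal I \<longleftrightarrow> subspace I \<and> (\<forall>x. \<forall>y\<in>I. br x y \<in> I)"

text \<open>The usual description of Cartan subalgebras of a semisimple Lie algebra: abelian,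
  equal to their own centralizer, and consisting of ad-diagonalizable elements.\<close>

definition cartan_subalgebra :: "'g set \<Rightarrow> bool" where
  "cartan_subalgebra \<h> \<longleftrightarrow>
     subspace \<h> \<and>
     (\<forall>x\<in>\<h>. \<forall>y\<in>\<h>. br x y = 0) \<and>
     (\<forall>x. (\<forall>y\<in>\<h>. br y x = 0) \<longrightarrow> x \<in> \<h>) \<and>
     (\<forall>y\<in>\<h>. span {x. \<exists>c. br y x = scale c x} = UNIV)"

text \<open>Linear functionals on a subspace are represented by functions on the whole space that
  vanish outside the subspace, so that equality of functionals is equality of functions.\<close>

definition dual :: "'g set \<Rightarrow> ('g \<Rightarrow> complex) set" where
  "dual \<h> = {f. (\<forall>x\<in>\<h>. \<forall>y\<in>\<h>. f (x + y) = f x + f y) \<and>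
                (\<forall>c. \<forall>x\<in>\<h>. f (scale c x) = c * f x) \<and>
                (\<forall>x. x \<notin> \<h> \<longrightarrow> f x = 0)}"

definition roots :: "'g set \<Rightarrow> ('g \<Rightarrow> complex) set" where
  "roots \<h> = {\<beta> \<in> dual \<h>. \<beta> \<noteq> (\<lambda>_. 0) \<and>
                (\<exists>x. x \<noteq> 0 \<and> (\<forall>y\<in>\<h>. br y x = scale (\<beta> y) x))}"

definition simple_roots :: "'g set \<Rightarrow> nat \<Rightarrow> (nat \<Rightarrow> 'g \<Rightarrow> complex) \<Rightarrow> bool" where
  "simple_roots \<h> n \<alpha> \<longleftrightarrow>
     (\<forall>a\<in>{1..n}. \<alpha> a \<in> roots \<h>) \<and>
     (\<forall>c :: nat \<Rightarrow> complex. (\<forall>x. (\<Sum>a=1..n. c a * \<alpha> a x) = 0) \<longrightarrow> (\<forall>a\<in>{1..n}. c a = 0)) \<and>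
     (\<forall>\<beta>\<in>roots \<h>. \<exists>c :: nat \<Rightarrow> int.
        (\<forall>x. \<beta> x = (\<Sum>a=1..n. of_int (c a) * \<alpha> a x)) \<and>
        ((\<forall>a\<in>{1..n}. c a \<ge> 0) \<or> (\<forall>a\<in>{1..n}. c a \<le> 0)))"

definition invariant_form :: "('g \<Rightarrow> 'g \<Rightarrow> complex) \<Rightarrow> bool" where
  "invariant_form B \<longleftrightarrow>
     (\<forall>x. Vector_Spaces.linear scale (*) (B x)) \<and>
     (\<forall>x y. B x y = B y x) \<and>
     (\<forall>x y z. B (br x y) z = B x (br y z))"

definition nondegenerate :: "('g \<Rightarrow> 'g \<Rightarrow> complex) \<Rightarrow> bool" where
  "nondegenerate B \<longleftrightarrow> (\<forall>x. (\<forall>y. B x y = 0) \<longrightarrow> x = 0)"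

end

text \<open>The bilinear form on the dual of \<open>\<h>\<close> obtained by transport of structure from the
  restriction to \<open>\<h>\<close> of a form \<open>B\<close> that is nondegenerate on \<open>\<h>\<close>.\<close>

definition dual_vector :: "'g set \<Rightarrow> ('g \<Rightarrow> 'g \<Rightarrow> complex) \<Rightarrow> ('g \<Rightarrow> complex) \<Rightarrow> 'g" where
  "dual_vector \<h> B f = (THE x. x \<in> \<h> \<and> (\<forall>y\<in>\<h>. B x y = f y))"

definition dual_form ::
  "'g set \<Rightarrow> ('g \<Rightarrow> 'g \<Rightarrow> complex) \<Rightarrow> ('g \<Rightarrow> complex) \<Rightarrow> ('g \<Rightarrow> complex) \<Rightarrow> complex" where
  "dual_form \<h> B f g = B (dual_vector \<h> B f) (dual_vector \<h> B g)"

context lie_algebra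
begin

definition long_root :: "'g set \<Rightarrow> ('g \<Rightarrow> 'g \<Rightarrow> complex) \<Rightarrow> ('g \<Rightarrow> complex) \<Rightarrow> bool" where
  "long_root \<h> B \<beta> \<longleftrightarrow> \<beta> \<in> roots \<h> \<and>
     (\<forall>\<gamma>\<in>roots \<h>. Re (dual_form \<h> B \<gamma> \<gamma>) \<le> Re (dual_form \<h> B \<beta> \<beta>))"

text \<open>On a simple Lie algebra the nondegenerate invariant forms are the nonzero multiples of
  the Killing form; the normalization singles out one of them.\<close>

definition standard_form :: "'g set \<Rightarrow> ('g \<Rightarrow> 'g \<Rightarrow> complex) \<Rightarrow> bool" where
  "standard_form \<h> B \<longleftrightarrow> invariant_form B \<and> nondegenerate B \<and>
     (\<forall>\<beta>. long_root \<h> B \<beta> \<longrightarrow> dual_form \<h> B \<beta> \<beta> = 2)"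

end

locale simple_lie_algebra = lie_algebra +
  assumes finite_dimensional: "\<exists>S. finite S \<and> span S = UNIV"
    and nonabelian: "\<exists>x y. br x y \<noteq> 0"
    and ideals_trivial: "lie_ideal I \<Longrightarrow> I = {0} \<or> I = UNIV"

locale based_simple_lie_algebra = simple_lie_algebra scale br
  for scale :: "complex \<Rightarrow> 'g::ab_group_add \<Rightarrow> 'g" and br +
  fixes \<h> :: "'g set" and B :: "'g \<Rightarrow> 'g \<Rightarrow> complex"
    and n :: nat and \<alpha> :: "nat \<Rightarrow> 'g \<Rightarrow> complex"
  assumes cartan: "cartan_subalgebra \<h>"
    and rank: "dim \<h> = n"
    and simple: "simple_roots \<h> n \<alpha>"
    and standard: "standard_form \<h> B"

text \<open>The numbers \<open>(\<alpha>\<^sub>a|\<alpha>\<^sub>b)\<close>. The standard form is real on the real span of the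
  roots, so \<open>Re\<close> only changes the type.\<close>

definition root_gram ::
  "'g set \<Rightarrow> ('g \<Rightarrow> 'g \<Rightarrow> complex) \<Rightarrow> (nat \<Rightarrow> 'g \<Rightarrow> complex) \<Rightarrow> nat \<Rightarrow> nat \<Rightarrow> real" where
  "root_gram \<h> B \<alpha> a b = Re (dual_form \<h> B (\<alpha> a) (\<alpha> b))"


section \<open>The string center equation\<close>

text \<open>Below, \<open>g a b\<close> stands for \<open>(\<alpha>\<^sub>a|\<alpha>\<^sub>b)\<close>.\<close>

definition families :: "nat \<Rightarrow> (nat \<Rightarrow> nat \<Rightarrow> nat) set" where
  "families n = {N. (\<forall>a m. N a m \<noteq> 0 \<longrightarrow> 1 \<le> a \<and> a \<le> n \<and> 1 \<le> m) \<and>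
                    finite {(a, m). N a m \<noteq> 0}}"

definition supp :: "(nat \<Rightarrow> nat \<Rightarrow> nat) \<Rightarrow> (nat \<times> nat) set" where
  "supp N = {(a, m). N a m > 0}"

definition tt :: "(nat \<Rightarrow> nat \<Rightarrow> real) \<Rightarrow> nat \<Rightarrow> real" where
  "tt g a = 2 / g a a"

definition kernel :: "(nat \<Rightarrow> nat \<Rightarrow> real) \<Rightarrow> nat \<times> nat \<Rightarrow> nat \<times> nat \<Rightarrow> real" where
  "kernel g = (\<lambda>(a, m) (b, k). g a b * min (tt g b * real m) (tt g a * real k))"

text \<open>Sums over all indices are written as sums over the finite support, outside of which the
  summands vanish.\<close>

definition gam :: "(nat \<Rightarrow> nat \<Rightarrow> nat) \<Rightarrow> nat \<Rightarrow> nat \<Rightarrow> nat" where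
  "gam \<nu> a m = (\<Sum>k | \<nu> a k > 0. min m k * \<nu> a k)"

definition PP ::
  "(nat \<Rightarrow> nat \<Rightarrow> real) \<Rightarrow> (nat \<Rightarrow> nat \<Rightarrow> nat) \<Rightarrow> (nat \<Rightarrow> nat \<Rightarrow> nat) \<Rightarrow> nat \<Rightarrow> nat \<Rightarrow> real" where
  "PP g \<nu> N a m =
     real (gam \<nu> a m) - (\<Sum>(b, k)\<in>supp N. kernel g (a, m) (b, k) * real (N b k))"

definition FF ::
  "(nat \<Rightarrow> nat \<Rightarrow> real) \<Rightarrow> (nat \<Rightarrow> nat \<Rightarrow> nat) \<Rightarrow> (nat \<Rightarrow> nat \<Rightarrow> nat) \<Rightarrow>
     nat \<times> nat \<Rightarrow> nat \<times> nat \<Rightarrow> real" where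
  "FF g \<nu> N = (\<lambda>(a, m) (b, k).
     (if a = b \<and> m = k then PP g \<nu> N a m else 0) + kernel g (a, m) (b, k) * real (N b k))"

text \<open>Leibniz formula, for matrices indexed by an arbitrary finite set.\<close>

definition set_det :: "'i set \<Rightarrow> ('i \<Rightarrow> 'i \<Rightarrow> real) \<Rightarrow> real" where
  "set_det I M = (\<Sum>p | p permutes I. of_int (sign p) * (\<Prod>i\<in>I. M i (p i)))"

definition RR ::
  "(nat \<Rightarrow> nat \<Rightarrow> real) \<Rightarrow> (nat \<Rightarrow> nat \<Rightarrow> nat) \<Rightarrow> (nat \<Rightarrow> nat \<Rightarrow> nat) \<Rightarrow> real" where
  "RR g \<nu> N = set_det (supp N) (FF g \<nu> N) *
     (\<Prod>(a, m)\<in>supp N. 1 / real (N a m) *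
        ((PP g \<nu> N a m + real (N a m) - 1) gchoose (N a m - 1)))"

definition AA ::
  "(nat \<Rightarrow> nat \<Rightarrow> real) \<Rightarrow> (nat \<Rightarrow> nat \<Rightarrow> nat) \<Rightarrow> (nat \<Rightarrow> nat \<Rightarrow> nat) \<Rightarrow>
     nat \<times> nat \<times> nat \<Rightarrow> nat \<times> nat \<times> nat \<Rightarrow> real" where
  "AA g \<nu> N = (\<lambda>(a, m, i) (b, k, j).
     (if a = b \<and> m = k \<and> i = j then PP g \<nu> N a m + real (N a m) else 0)
     + kernel g (a, m) (b, k) - (if a = b \<and> m = k then 1 else 0))"

definition unknowns :: "(nat \<Rightarrow> nat \<Rightarrow> nat) \<Rightarrow> (nat \<times> nat \<times> nat) set" where
  "unknowns N = {(a, m, i). (a, m) \<in> supp N \<and> 1 \<le> i \<and> i \<le> N a m}"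

text \<open>The exponents are integers because \<open>2 (\<alpha>\<^sub>a|\<alpha>\<^sub>b) / (\<alpha>\<^sub>b|\<alpha>\<^sub>b)\<close> is one; the floor only
  converts them to type \<^typ>\<open>int\<close>. Solutions are extensional functions on the set of unknowns.\<close>

definition string_center_solutions ::
  "(nat \<Rightarrow> nat \<Rightarrow> real) \<Rightarrow> (nat \<Rightarrow> nat \<Rightarrow> nat) \<Rightarrow> (nat \<Rightarrow> nat \<Rightarrow> nat) \<Rightarrow>
     (nat \<times> nat \<times> nat \<Rightarrow> complex) set" where
  "string_center_solutions g \<nu> N =
     {z \<in> unknowns N \<rightarrow>\<^sub>E - {0}.
        \<forall>(a, m, i)\<in>unknowns N.
          (\<Prod>(b, k)\<in>supp N. \<Prod>j=1..N b k. z (b, k, j) powi \<lfloor>AA g \<nu> N (a, m, i) (b, k, j)\<rfloor>)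
          = (- 1) powi \<lfloor>PP g \<nu> N a m + real (N a m) + 1\<rfloor>}"

definition off_diagonal ::
  "(nat \<Rightarrow> nat \<Rightarrow> nat) \<Rightarrow> (nat \<times> nat \<times> nat \<Rightarrow> complex) \<Rightarrow> bool" where
  "off_diagonal N z \<longleftrightarrow> (\<forall>(a, m)\<in>supp N. inj_on (\<lambda>i. z (a, m, i)) {1..N a m})"

definition off_diagonal_solutions ::
  "(nat \<Rightarrow> nat \<Rightarrow> real) \<Rightarrow> (nat \<Rightarrow> nat \<Rightarrow> nat) \<Rightarrow> (nat \<Rightarrow> nat \<Rightarrow> nat) \<Rightarrow>
     (nat \<times> nat \<times> nat \<Rightarrow> complex) set" where
  "off_diagonal_solutions g \<nu> N = {z \<in> string_center_solutions g \<nu> N. off_diagonal N z}"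

end

theory Submission imports Defs "Jordan_Normal_Form.Determinant" begin

text \<open>
  Write \<open>x = (a, m)\<close> for a pair in the support of \<open>N\<close>, \<open>K\<close> for the integer matrix
  \<open>(\<alpha>\<^sub>a|\<alpha>\<^sub>b) min (t\<^sub>b m) (t\<^sub>a k)\<close> and \<open>q\<^sub>x = P\<^sub>x + N\<^sub>x\<close>. The equation of index \<open>(x, i)\<close> reads
  \<open>z\<^sub>x\<^sub>i ^ q\<^sub>x = w\<^sub>x\<close>, where \<open>w\<^sub>x\<close> involves only the products of the unknowns over whole blocks
  and so does not depend on \<open>i\<close>. Hence within a block the unknowns differ by \<open>q\<^sub>x\<close>-th roots of
  unity, and an off-diagonal solution is \<open>z\<^sub>x\<^sub>i = u\<^sub>x c\<^sub>x\<^sub>i\<close> with \<open>c\<^sub>x\<^sub>1 = 1\<close> and with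
  \<open>c\<^sub>x\<^sub>2, c\<^sub>x\<^sub>3, \<dots>\<close> distinct \<open>q\<^sub>x\<close>-th roots of unity other than \<open>1\<close>. There are
  \<open>(q\<^sub>x - 1) (q\<^sub>x - 2) \<dots> (q\<^sub>x - N\<^sub>x + 1)\<close> choices of \<open>c\<^sub>x\<close>. Once \<open>c\<close> is chosen, what remains is
  a monomial system for the \<open>u\<^sub>x\<close> whose exponent matrix is \<open>F\<close>, the matrix of the statement, and
  whose right-hand sides are nonzero. Such a system has \<open>\<bar>det F\<bar>\<close> solutions as soon as
  \<open>det F \<noteq> 0\<close> (\<open>card_monomial_solutions\<close>). The product of the two counts, divided by the
  factorials, is \<open>R(\<nu>, N)\<close>; the bijection is in \<open>card_distinct_solutions\<close>.

  For the absolute value to disappear, \<open>det F\<close> must be positive. Dividing the columns of \<open>F\<close> by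
  the \<open>N\<^sub>x\<close> leaves \<open>K\<close> plus a diagonal matrix with entries \<open>P\<^sub>x / N\<^sub>x \<ge> 0\<close>. The matrix \<open>K\<close> is
  positive definite because the Gram matrix of the simple roots is, and because
  \<open>min (m / t\<^sub>a) (k / t\<^sub>b)\<close> is the length of an intersection of two intervals \<open>[0, m / t\<^sub>a]\<close> and
  \<open>[0, k / t\<^sub>b]\<close> (\<open>min_form_pos\<close>, \<open>kernel_pos_def\<close>, \<open>set_det_pos\<close>).

  About the Lie algebra, therefore, three facts are needed: the Gram matrix of the simple roots is
  symmetric, it is positive definite, and \<open>2 (\<alpha>\<^sub>a|\<alpha>\<^sub>b) / (\<alpha>\<^sub>b|\<alpha>\<^sub>b)\<close> is an integer. They come
  from the classical structure theory, developed here from the definitions. A common eigenbasis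
  of the Cartan subalgebra shows that the form is nondegenerate on it; root strings give
  integrality (\<open>weight_at_root_vector\<close>); and the standard form is a positive multiple of the
  Killing form, which on the Cartan subalgebra is a sum of squares of weights
  (\<open>killing_proportional\<close>, \<open>killing_scalar\<close>, \<open>root_gram_pos_def\<close>).
\<close>


section \<open>Eigenvectors in a vector space\<close>

context vector_space
begin

lemma eigenvectors_independent:
  assumes f: "Vector_Spaces.linear scale scale f"
    and "finite C" and "\<And>c. c \<in> C \<Longrightarrow> f (v c) = scale (\<mu> c) (v c)"
    and "inj_on \<mu> C" and "(\<Sum>c\<in>C. v c) = 0"
  shows "\<forall>c\<in>C. v c = 0"
proof -
  interpret f: module_hom scale scale f using f by (simp add: module_hom_iff_linear)
  show ?thesis using assms(2-)
  proof (induction C arbitrary: v rule: finite_induct)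
    case empty
    then show ?case by simp
  next
    case (insert d C)
    \<comment> \<open>Applying \<open>f - \<mu> d\<close> to the relation removes the term of index \<open>d\<close>.\<close>
    let ?w = "\<lambda>c. scale (\<mu> c - \<mu> d) (v c)"
    have "(\<Sum>c\<in>insert d C. ?w c) = f (\<Sum>c\<in>insert d C. v c) - scale (\<mu> d) (\<Sum>c\<in>insert d C. v c)"
      unfolding f.sum scale_sum_right sum_subtractf[symmetric]
      by (intro sum.cong) (simp_all add: insert.prems(1) scale_left_diff_distrib)
    also have "\<dots> = 0"
      by (simp only: insert.prems(3) f.zero scale_zero_right diff_self)
    finally have "(\<Sum>c\<in>C. ?w c) = 0"
      using insert.hyps by simp
    moreover have "f (?w c) = scale (\<mu> c) (?w c)" if "c \<in> C" for c
      using insert.prems(1)[of c] that by (simp add: f.scale mult.commute)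
    moreover have "inj_on \<mu> C"
      using insert.prems(2) by simp
    ultimately have w: "\<forall>c\<in>C. ?w c = 0"
      using insert.IH[of ?w] by blast
    have v: "v c = 0" if "c \<in> C" for c
    proof -
      have "\<mu> c \<noteq> \<mu> d"
        using insert.prems(2) insert.hyps(2) that by (auto simp: inj_on_def)
      then show ?thesis using w that by auto
    qed
    then have "v d = 0"
      using insert.prems(3) insert.hyps by simp
    with v show ?case by simp
  qed
qed

text \<open>In a finite-dimensional space this makes root strings finite: the terms of such a sequence, if
  all nonzero, would be infinitely many independent vectors.\<close>

lemma eigenvector_sequence_vanishes:
  fixes v :: "nat \<Rightarrow> 'b"
  assumes f: "Vector_Spaces.linear scale scale f"
    and v: "\<And>k. f (v k) = scale (\<mu> k) (v k)" and \<mu>: "inj \<mu>"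
    and S: "finite S" "span S = UNIV"
  shows "\<exists>k. v k = 0"
proof (rule ccontr)
  assume "\<not> ?thesis"
  then have nz: "\<And>k. v k \<noteq> 0" by simp
  have inj: "inj v"
  proof (rule injI)
    fix i j assume "v i = v j"
    then have "scale (\<mu> i) (v i) = scale (\<mu> j) (v i)"
      using v[of i] v[of j] by metis
    then have "\<mu> i = \<mu> j" using nz[of i] by auto
    then show "i = j" using \<mu> by (simp add: inj_eq)
  qed
  have "independent (range v)"
    unfolding independent_explicit_finite_subsets
  proof (intro allI impI)
    fix T u assume T: "T \<subseteq> range v" "finite T" "(\<Sum>x\<in>T. scale (u x) x) = 0"
    define K where "K = v -` T"
    have K: "finite K" "v ` K = T"
      using T inj unfolding K_def by (auto intro: finite_vimageI)
    have f1: "f (scale (u (v k)) (v k)) = scale (\<mu> k) (scale (u (v k)) (v k))" for k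
    proof -
      interpret f: module_hom scale scale f using f by (simp add: module_hom_iff_linear)
      show ?thesis by (simp add: f.scale v mult.commute)
    qed
    have "(\<Sum>k\<in>K. scale (u (v k)) (v k)) = 0"
      using T(3) inj unfolding K(2)[symmetric]
      by (subst (asm) sum.reindex) (auto simp: inj_on_def)
    then have "\<forall>k\<in>K. scale (u (v k)) (v k) = 0"
      using f1 \<mu> by (intro eigenvectors_independent[OF f K(1)]) (auto simp: inj_on_def)
    then show "\<forall>x\<in>T. u x = 0"
      using nz K(2) by auto
  qed
  then have "finite (range v)"
    using independent_span_bound[OF S(1)] S(2) by blast
  then show False
    using inj by (simp add: finite_image_iff)
qed

text \<open>The components are indexed by the eigenvalues themselves, one for each, so that
  \<open>eigenvectors_independent\<close> applies to relations between them.\<close>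

lemma eigenvector_decomposition:
  assumes f: "Vector_Spaces.linear scale scale f"
    and x: "x \<in> span {x. \<exists>c. f x = scale c x}"
  shows "\<exists>C v. finite C \<and> (\<forall>c. f (v c) = scale c (v c)) \<and> (\<forall>c. c \<notin> C \<longrightarrow> v c = 0) \<and> x = (\<Sum>c\<in>C. v c)"
proof -
  interpret f: module_hom scale scale f using f by (simp add: module_hom_iff_linear)
  let ?P = "\<lambda>x. \<exists>C v. finite C \<and> (\<forall>c. f (v c) = scale c (v c)) \<and> (\<forall>c. c \<notin> C \<longrightarrow> v c = 0) \<and> x
      = (\<Sum>c\<in>C. v c)"
  have "?P x"
    using x
  proof (induction rule: span_induct_alt)
    case base
    show ?case
      by (intro exI[of _ "{}"] exI[of _ "\<lambda>_. 0"]) (simp add: f.zero)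
  next
    case (step a b y)
    from step.hyps obtain d where d: "f b = scale d b" by auto
    from step.IH obtain C v where v: "finite C" "\<And>c. f (v c) = scale c (v c)"
      "\<And>c. c \<notin> C \<Longrightarrow> v c = 0" "y = (\<Sum>c\<in>C. v c)" by metis
    let ?w = "v(d := v d + scale a b)"
    have "f (?w c) = scale c (?w c)" for c
      by (simp add: v(2) d f.add f.scale scale_right_distrib mult.commute)
    moreover have "(\<Sum>c\<in>insert d C. ?w c) = scale a b + y"
    proof -
      have "(\<Sum>c\<in>insert d C. ?w c) = ?w d + (\<Sum>c\<in>C - {d}. v c)"
        by (subst sum.insert_remove) (auto simp: v(1))
      also have "(\<Sum>c\<in>C. v c) = (\<Sum>c\<in>insert d C. v c)"
        by (rule sum.mono_neutral_left) (auto simp: v(1,3))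
      then have "v d + (\<Sum>c\<in>C - {d}. v c) = y"
        unfolding v(4) by (simp add: sum.insert_remove v(1))
      then have "?w d + (\<Sum>c\<in>C - {d}. v c) = scale a b + y"
        by (simp add: algebra_simps)
      finally show ?thesis .
    qed
    moreover have "finite (insert d C)" "\<forall>c. c \<notin> insert d C \<longrightarrow> ?w c = 0"
      using v(1,3) by auto
    ultimately show ?case by (metis (no_types, lifting))
  qed
  then show ?thesis .
qed

end

section \<open>Weight vectors in a Lie algebra\<close>

context lie_algebra
begin

lemma br_add_left: "br (x + y) z = br x z + br y z"
  and br_scale_left: "br (scale c x) z = scale c (br x z)"
  and br_zero_left [simp]: "br 0 z = 0"
  and br_sum_left: "br (sum f S) z = (\<Sum>i\<in>S. br (f i) z)"
proof -
  interpret l: module_hom scale scale "\<lambda>x. br x z"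
    using br_linear_left by (simp add: module_hom_iff_linear)
  show "br (x + y) z = br x z + br y z" "br (scale c x) z = scale c (br x z)" "br 0 z = 0"
    "br (sum f S) z = (\<Sum>i\<in>S. br (f i) z)"
    using l.add l.scale l.zero l.sum by auto
qed

lemma br_add_right: "br z (x + y) = br z x + br z y"
  and br_scale_right: "br z (scale c x) = scale c (br z x)"
  and br_zero_right [simp]: "br z 0 = 0"
  and br_diff_right: "br z (x - y) = br z x - br z y"
  and br_sum_right: "br z (sum f S) = (\<Sum>i\<in>S. br z (f i))"
proof -
  interpret l: module_hom scale scale "br z"
    using br_linear_right by (simp add: module_hom_iff_linear)
  show "br z (x + y) = br z x + br z y" "br z (scale c x) = scale c (br z x)" "br z 0 = 0"
    "br z (x - y) = br z x - br z y" "br z (sum f S) = (\<Sum>i\<in>S. br z (f i))"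
    using l.add l.scale l.zero l.diff l.sum by auto
qed

lemma br_antisym: "br x y = - br y x"
proof -
  have "br (x + y) (x + y) = br x x + br y x + (br x y + br y y)"
    by (simp only: br_add_left br_add_right)
  then have "br x y + br y x = 0"
    by (simp add: br_alternating add.commute)
  then show ?thesis by (simp add: eq_neg_iff_add_eq_0)
qed

lemma br_minus_right: "br x (- y) = - br x y"
  using br_diff_right[of x 0 y] by simp

lemma br_derivation: "br x (br y z) = br (br x y) z + br y (br x z)"
proof -
  have "br x (br y z) + br y (br z x) + br z (br x y) = 0" by (rule jacobi)
  moreover have "br y (br z x) = - br y (br x z)"
    by (subst br_antisym[of z x]) (rule br_minus_right)
  moreover have "br z (br x y) = - br (br x y) z" by (rule br_antisym)
  ultimately show ?thesis by (simp add: algebra_simps)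
qed

text \<open>Only the values of \<open>l\<close> on \<open>\<h>\<close> matter, so sums and differences of weights can be formed
  pointwise, whatever they are outside \<open>\<h>\<close>.\<close>

definition weight_vector :: "'g set \<Rightarrow> ('g \<Rightarrow> complex) \<Rightarrow> 'g \<Rightarrow> bool" where
  "weight_vector \<h> l x \<longleftrightarrow> (\<forall>y\<in>\<h>. br y x = scale (l y) x)"

lemma weight_vectorD: "weight_vector \<h> l x \<Longrightarrow> y \<in> \<h> \<Longrightarrow> br y x = scale (l y) x"
  by (simp add: weight_vector_def)

lemma weight_vector_br:
  assumes "weight_vector \<h> l x" "weight_vector \<h> m y"
  shows "weight_vector \<h> (\<lambda>h. l h + m h) (br x y)"
  unfolding weight_vector_def
proof
  fix h assume "h \<in> \<h>"
  then show "br h (br x y) = scale (l h + m h) (br x y)"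
    using assms br_derivation[of h x y]
    by (simp add: weight_vector_def br_scale_left br_scale_right scale_left_distrib)
qed

lemma weight_vector_scale:
  "weight_vector \<h> l x \<Longrightarrow> weight_vector \<h> l (scale c x)"
  by (simp add: weight_vector_def br_scale_right mult.commute)

text \<open>Invariance moves \<open>h\<close> from one argument to the other, so \<open>(l h + m h) B(x, y) = 0\<close>. This is used
  both for the standard form and for the Killing form.\<close>

lemma invariant_orthogonal:
  assumes "invariant_form B" "weight_vector \<h> l x" "weight_vector \<h> m y"
    and "h \<in> \<h>" "l h + m h \<noteq> 0"
  shows "B x y = 0"
proof -
  have lin: "B u (scale c v) = c * B u v" for u v c
    using assms(1) unfolding invariant_form_def
    by (auto simp: module_hom_iff_linear[symmetric] module_hom.scale)
  have sym: "B u v = B v u" for u v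
    using assms(1) by (simp add: invariant_form_def)
  have "m h * B x y = B x (br h y)"
    using assms(3,4) by (simp add: weight_vector_def lin)
  also have "\<dots> = B (br x h) y"
    using assms(1) by (metis invariant_form_def)
  also have "br x h = scale (- l h) x"
    using assms(2,4) br_antisym[of x h] by (simp add: weight_vector_def)
  also have "B (scale (- l h) x) y = - l h * B x y"
    by (metis sym lin)
  finally have "(l h + m h) * B x y = 0" by (simp add: algebra_simps)
  then show ?thesis using assms(5) by simp
qed

text \<open>Simultaneous diagonalisation: a new commuting operator preserves each common eigenspace, so the
  eigencomponents of a common eigenvector are again common eigenvectors.\<close>

lemma common_eigenvectors_span:
  assumes "finite Y" and comm: "\<And>y y'. y \<in> Y \<Longrightarrow> y' \<in> Y \<Longrightarrow> br y y' = 0"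
    and diag: "\<And>y. y \<in> Y \<Longrightarrow> span {x. \<exists>c. br y x = scale c x} = UNIV"
  shows "span {x. \<forall>y\<in>Y. \<exists>c. br y x = scale c x} = UNIV"
  using assms
proof (induction Y rule: finite_induct)
  case empty
  then show ?case by simp
next
  case (insert y Y)
  let ?E = "\<lambda>Y. {x. \<forall>y\<in>Y. \<exists>c. br y x = scale c x}"
  have "?E Y \<subseteq> span (?E (insert y Y))"
  proof
    fix x assume x: "x \<in> ?E Y"
    have "x \<in> span {x. \<exists>c. br y x = scale c x}"
      using insert.prems(2)[of y] by simp
    from eigenvector_decomposition[OF br_linear_right this]
    obtain C v where v: "finite C" "\<And>c. br y (v c) = scale c (v c)" "x = (\<Sum>c\<in>C. v c)"
      by metis
    have "v c \<in> ?E (insert y Y)" if "c \<in> C" for c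
    proof -
      have "\<exists>d. br y' (v c) = scale d (v c)" if "y' \<in> Y" for y'
      proof -
        from x that obtain d where d: "br y' x = scale d x" by auto
        \<comment> \<open>The components of \<open>ad y' - d\<close> applied to \<open>x\<close> lie in different eigenspaces of \<open>ad y\<close>.\<close>
        let ?w = "\<lambda>c. br y' (v c) - scale d (v c)"
        have "(\<Sum>c\<in>C. ?w c) = br y' x - scale d x"
          unfolding v(3) by (simp add: br_sum_right scale_sum_right sum_subtractf)
        also have "\<dots> = 0" using d by simp
        finally have s: "(\<Sum>c\<in>C. ?w c) = 0" .
        have "br y (?w c) = scale c (?w c)" for c
          using br_derivation[of y y' "v c"] insert.prems(1)[of y y'] that
          by (simp add: br_diff_right br_scale_right v(2) scale_right_diff_distrib mult.commute)
        then have "\<forall>c\<in>C. ?w c = 0"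
          by (intro eigenvectors_independent[OF br_linear_right v(1), where \<mu> =
              "\<lambda>c. c"]) (use s in auto)
        then show ?thesis using \<open>c \<in> C\<close> by auto
      qed
      then show ?thesis using v(2) by auto
    qed
    then show "x \<in> span (?E (insert y Y))"
      unfolding v(3) by (intro span_sum span_base)
  qed
  then have "span (?E Y) \<subseteq> span (?E (insert y Y))"
    using span_minimal[OF _ subspace_span] by blast
  moreover have "span (?E Y) = UNIV"
    using insert.IH insert.prems by blast
  ultimately show ?case by auto
qed

end

section \<open>Weights and roots of a simple Lie algebra\<close>

context based_simple_lie_algebra
begin

lemma inv: "invariant_form B" and nondeg: "nondegenerate B"
  using standard by (auto simp: standard_form_def)

lemma B_add_right: "B x (y + z) = B x y + B x z"
  and B_scale_right: "B x (scale c y) = c * B x y"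
  and B_zero_right [simp]: "B x 0 = 0"
  and B_diff_right: "B x (y - z) = B x y - B x z"
  and B_sum_right: "B x (sum f S) = (\<Sum>i\<in>S. B x (f i))"
proof -
  interpret l: module_hom scale "(*)" "B x"
    using inv by (auto simp: invariant_form_def module_hom_iff_linear)
  show "B x (y + z) = B x y + B x z" "B x (scale c y) = c * B x y" "B x 0 = 0"
    "B x (y - z) = B x y - B x z" "B x (sum f S) = (\<Sum>i\<in>S. B x (f i))"
    using l.add l.scale l.zero l.diff l.sum by auto
qed

lemma B_sym: "B x y = B y x"
  using inv by (simp add: invariant_form_def)

lemma B_br: "B (br x y) z = B x (br y z)"
  using inv unfolding invariant_form_def by blast

lemma B_add_left: "B (x + y) z = B x z + B y z"
  and B_scale_left: "B (scale c x) z = c * B x z"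
  and B_zero_left [simp]: "B 0 z = 0"
  and B_diff_left: "B (x - y) z = B x z - B y z"
  and B_sum_left: "B (sum f S) z = (\<Sum>i\<in>S. B (f i) z)"
  by (simp_all add: B_sym[of _ z] B_add_right B_scale_right B_diff_right B_sum_right)

lemma B_nondegenerate: "(\<And>y. B x y = 0) \<Longrightarrow> x = 0"
  using nondeg by (auto simp: nondegenerate_def)

lemma h_subspace: "subspace \<h>"
  and h_abelian: "x \<in> \<h> \<Longrightarrow> y \<in> \<h> \<Longrightarrow> br x y = 0"
  and h_self_centralizing: "(\<And>y. y \<in> \<h> \<Longrightarrow> br y x = 0) \<Longrightarrow> x \<in> \<h>"
  and h_diagonalizable: "y \<in> \<h> \<Longrightarrow> span {x. \<exists>c. br y x = scale c x} = UNIV"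
  using cartan unfolding cartan_subalgebra_def by blast+

text \<open>The centre is an ideal, and it is not everything since the algebra is not abelian.\<close>

lemma central_eq_zero:
  assumes "\<And>y. br x y = 0"
  shows "x = 0"
proof -
  let ?Z = "{x. \<forall>y. br x y = 0}"
  have "lie_ideal ?Z"
    unfolding lie_ideal_def subspace_def
    by (auto simp: br_add_left br_scale_left) (metis br_antisym neg_0_equal_iff_equal br_zero_left)
  then have "?Z = {0} \<or> ?Z = UNIV" by (rule ideals_trivial)
  moreover have "?Z \<noteq> UNIV" using nonabelian by auto
  ultimately show ?thesis using assms by auto
qed

abbreviation wv :: "('g \<Rightarrow> complex) \<Rightarrow> 'g \<Rightarrow> bool" where
  "wv \<equiv> weight_vector \<h>"

text \<open>A finite basis of \<open>\<h>\<close> has a spanning set of common eigenvectors, and these are automatically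
  eigenvectors of all of \<open>\<h>\<close>.\<close>

lemma weight_vectors_span: "span {x. \<exists>l. wv l x} = UNIV"
proof -
  obtain S where S: "finite S" "span S = UNIV" using finite_dimensional by auto
  obtain Y where Y: "Y \<subseteq> \<h>" "independent Y" "\<h> \<subseteq> span Y"
    by (rule maximal_independent_subset)
  have fY: "finite Y"
    using independent_span_bound[OF S(1) Y(2)] S(2) by auto
  have "{x. \<forall>y\<in>Y. \<exists>c. br y x = scale c x} \<subseteq> {x. \<exists>l. wv l x}"
  proof safe
    fix x assume x: "\<forall>y\<in>Y. \<exists>c. br y x = scale c x"
    have "\<exists>c. br y x = scale c x" if "y \<in> span Y" for y
      using that
    proof (induction rule: span_induct_alt)
      case base
      show ?case by (rule exI[of _ 0]) simp
    next
      case (step c y z)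
      then obtain d where d: "br y x = scale d x" using x by auto
      from step obtain e where "br z x = scale e x" by auto
      with d have "br (scale c y + z) x = scale (c * d + e) x"
        by (simp add: br_add_left br_scale_left scale_left_distrib)
      then show ?case ..
    qed
    then have "\<forall>y\<in>\<h>. \<exists>c. br y x = scale c x" using Y(3) by auto
    then show "\<exists>l. wv l x" unfolding weight_vector_def by (rule bchoice)
  qed
  moreover have "span {x. \<forall>y\<in>Y. \<exists>c. br y x = scale c x} = UNIV"
  proof (rule common_eigenvectors_span[OF fY])
    show "br y y' = 0" if "y \<in> Y" "y' \<in> Y" for y y'
      using that Y(1) by (intro h_abelian) auto
    show "span {x. \<exists>c. br y x = scale c x} = UNIV" if "y \<in> Y" for y
      using that Y(1) by (intro h_diagonalizable) auto
  qed
  ultimately show ?thesis using span_mono by blast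
qed

text \<open>A basis of the whole algebra that diagonalises \<open>\<h>\<close>. It replaces the root space decomposition:
  its members of weight zero lie in \<open>\<h>\<close>, and the weights of the others are roots.\<close>

definition weight_basis :: "'g set" where
  "weight_basis = (SOME E. E \<subseteq> {x. \<exists>l. wv l x} \<and> independent E \<and> span E = UNIV)"

definition weight :: "'g \<Rightarrow> 'g \<Rightarrow> complex" where
  "weight x = (SOME l. wv l x)"

lemma weight_basis:
  shows weight_basis_independent: "independent weight_basis"
    and weight_basis_span: "span weight_basis = UNIV"
    and weight_basis_weight: "b \<in> weight_basis \<Longrightarrow> wv (weight b) b"
    and weight_basis_nonzero: "b \<in> weight_basis \<Longrightarrow> b \<noteq> 0"
    and weight_basis_finite: "finite weight_basis"
proof -
  have "\<exists>E. E \<subseteq> {x. \<exists>l. wv l x} \<and> independent E \<and> span E = UNIV"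
  proof -
    obtain E where E: "E \<subseteq> {x. \<exists>l. wv l x}" "independent E" "{x. \<exists>l. wv l x} \<subseteq> span E"
      by (rule maximal_independent_subset)
    then show ?thesis
      using weight_vectors_span span_minimal[OF E(3) subspace_span] by blast
  qed
  from someI_ex[OF this]
  have *: "weight_basis \<subseteq> {x. \<exists>l. wv l x}" "independent weight_basis" "span weight_basis = UNIV"
    unfolding weight_basis_def by auto
  then show "independent weight_basis" "span weight_basis = UNIV" by auto
  show "wv (weight b) b" if "b \<in> weight_basis"
  proof -
    have "\<exists>l. wv l b" using *(1) that by auto
    then show ?thesis unfolding weight_def by (rule someI_ex)
  qed
  show "b \<noteq> 0" if "b \<in> weight_basis"
    using *(2) that dependent_zero by blast
  obtain S where S: "finite S" "span S = UNIV" using finite_dimensional by auto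
  show "finite weight_basis"
    using independent_span_bound[OF S(1) *(2)] S(2) by auto
qed

lemma linear_eq_zero_on_weight_basis:
  assumes "\<And>b. b \<in> weight_basis \<Longrightarrow> f b = 0"
    and "\<And>x y. f (x + y) = f x + f y" and "\<And>c x. f (scale c x) = c * f x"
  shows "f x = (0 :: complex)"
proof -
  have "subspace {x. f x = 0}"
    using assms(3)[of 0 0] by (auto simp: subspace_def assms(2,3))
  then have "span weight_basis \<subseteq> {x. f x = 0}"
    using assms(1) by (intro span_minimal) auto
  then show ?thesis using weight_basis_span by auto
qed

text \<open>An element of \<open>\<h>\<close> is orthogonal to every basis vector of nonzero weight, and the basis vectors
  of weight zero lie in \<open>\<h>\<close> because \<open>\<h>\<close> is its own centraliser.\<close>

lemma B_nondegenerate_on_cartan: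
  assumes x: "x \<in> \<h>" and orth: "\<And>y. y \<in> \<h> \<Longrightarrow> B x y = 0"
  shows "x = 0"
proof (rule B_nondegenerate)
  fix y
  show "B x y = 0"
  proof (rule linear_eq_zero_on_weight_basis[of "B x"])
    fix b assume b: "b \<in> weight_basis"
    show "B x b = 0"
    proof (cases "\<exists>h\<in>\<h>. weight b h \<noteq> 0")
      case True
      then obtain h where h: "h \<in> \<h>" "weight b h \<noteq> 0" by auto
      have "wv (\<lambda>_. 0) x"
        using x h_abelian by (auto simp: weight_vector_def)
      then show ?thesis
        using weight_basis_weight[OF b] h by (intro invariant_orthogonal[OF inv]) auto
    next
      case False
      then have "b \<in> \<h>"
        using weight_basis_weight[OF b] by (intro h_self_centralizing)
            (auto simp: weight_vector_def)
      then show ?thesis by (rule orth)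
    qed
  qed (simp_all add: B_add_right B_scale_right)
qed

lemma dual_vector_eqI:
  assumes "t \<in> \<h>" "\<And>y. y \<in> \<h> \<Longrightarrow> B t y = f y"
  shows "dual_vector \<h> B f = t"
  unfolding dual_vector_def
proof (rule the_equality)
  show "t \<in> \<h> \<and> (\<forall>y\<in>\<h>. B t y = f y)" using assms by auto
  fix x assume x: "x \<in> \<h> \<and> (\<forall>y\<in>\<h>. B x y = f y)"
  have "x - t = 0"
    using x assms h_subspace
    by (intro B_nondegenerate_on_cartan) (auto simp: subspace_diff B_diff_left)
  then show "x = t" by simp
qed

lemma root_nonzero:
  assumes "a \<in> roots \<h>"
  obtains y where "y \<in> \<h>" "a y \<noteq> 0"
proof -
  have "a \<noteq> (\<lambda>_. 0)" and out: "\<And>x. x \<notin> \<h> \<Longrightarrow> a x = 0"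
    using assms by (simp_all add: roots_def dual_def)
  then obtain y where "a y \<noteq> 0" by blast
  then show thesis using that out by blast
qed

abbreviation root_vector :: "('g \<Rightarrow> complex) \<Rightarrow> 'g" (\<open>\<t>\<close>) where
  "\<t> a \<equiv> dual_vector \<h> B a"

text \<open>Pairing a root vector \<open>e\<close> with a basis vector that is not orthogonal to it, scaled to
  \<open>B(e, f) = 1\<close>, produces the vector \<open>[e, f]\<close> of \<open>\<h>\<close> that represents the root; in particular the
  description in \<open>dual_vector\<close> is not void. Up to normalisation \<open>e\<close>, \<open>f\<close>, \<open>[e, f]\<close> is the
  standard \<open>sl\<^sub>2\<close>-triple, but nothing is divided by \<open>a(\<t> a)\<close>, which is not yet known to be
  nonzero.\<close>

lemma root_triple:
  assumes a: "a \<in> roots \<h>"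
  obtains e f where "wv a e" "e \<noteq> 0" "wv (\<lambda>h. - a h) f" "\<t> a = br e f" "\<t> a \<in> \<h>" "\<And>h. h \<in> \<h>
      \<Longrightarrow> B (\<t> a) h = a h"
proof -
  from a obtain e where e: "wv a e" "e \<noteq> 0"
    by (auto simp: roots_def weight_vector_def)
  obtain b where b: "b \<in> weight_basis" "B e b \<noteq> 0"
  proof (rule ccontr)
    assume "\<not> thesis"
    then have "\<And>b. b \<in> weight_basis \<Longrightarrow> B e b = 0" using that by blast
    then have "B e y = 0" for y
      by (rule linear_eq_zero_on_weight_basis[of "B e", OF _ B_add_right B_scale_right])
    then show False using B_nondegenerate e(2) by blast
  qed
  have wb: "wv (\<lambda>h. - a h) b"
  proof -
    have "weight b h = - a h" if "h \<in> \<h>" for h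
      using invariant_orthogonal[OF inv e(1) weight_basis_weight[OF b(1)] that] b(2)
      by (auto simp: eq_neg_iff_add_eq_0 add.commute)
    then show ?thesis
      using weight_basis_weight[OF b(1)] by (simp add: weight_vector_def)
  qed
  define f where "f = scale (1 / B e b) b"
  have f: "wv (\<lambda>h. - a h) f" "B e f = 1"
    using wb b(2) by (auto simp: f_def weight_vector_scale B_scale_right)
  have in_h: "br e f \<in> \<h>"
    using weight_vector_br[OF e(1) f(1)] by (intro h_self_centralizing)
        (auto simp: weight_vector_def)
  have B_h: "B (br e f) h = a h" if "h \<in> \<h>" for h
  proof -
    have "br f h = scale (a h) f"
      using f(1) that br_antisym[of f h] by (simp add: weight_vector_def)
    then show ?thesis by (simp add: B_br B_scale_right f(2))
  qed
  have t: "\<t> a = br e f" using in_h B_h by (rule dual_vector_eqI)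
  show thesis by (rule that[OF e f(1) t]) (simp_all add: t in_h B_h)
qed

lemma root_vector:
  assumes a: "a \<in> roots \<h>"
  shows root_vector_in_cartan: "\<t> a \<in> \<h>"
    and B_root_vector: "h \<in> \<h> \<Longrightarrow> B (\<t> a) h = a h"
proof -
  obtain e f where *: "\<t> a \<in> \<h>" "\<And>h. h \<in> \<h> \<Longrightarrow> B (\<t> a) h = a h"
    using root_triple[OF a] by blast
  show "\<t> a \<in> \<h>" "h \<in> \<h> \<Longrightarrow> B (\<t> a) h = a h" by (fact *)+
qed

end

section \<open>Root strings and integrality\<close>

context based_simple_lie_algebra
begin

lemma iterated_weight_vector:
  assumes e: "wv a e" and x: "wv l x"
  shows "wv (\<lambda>h. l h + of_nat k * a h) ((br e ^^ k) x)"
proof (induction k)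
  case 0
  then show ?case using x by simp
next
  case (Suc k)
  show ?case
    using weight_vector_br[OF e Suc.IH]
    by (simp add: algebra_simps)
qed

lemma iterated_weight_vector_vanishes:
  assumes e: "wv a e" and x: "wv l x" and y: "y \<in> \<h>" "a y \<noteq> 0"
  shows "\<exists>k. (br e ^^ k) x = 0"
proof -
  obtain S where S: "finite S" "span S = UNIV" using finite_dimensional by auto
  show ?thesis
  proof (rule eigenvector_sequence_vanishes[OF br_linear_right _ _ S])
    show "br y ((br e ^^ k) x) = scale (l y + of_nat k * a y) ((br e ^^ k) x)" for k
      using weight_vectorD[OF iterated_weight_vector[OF e x] y(1)] .
    show "inj (\<lambda>k::nat. l y + of_nat k * a y)"
      using y(2) by (auto intro!: injI)
  qed
qed

lemma last_nonzero_iterate: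
  fixes g :: "'g \<Rightarrow> 'g"
  assumes "x \<noteq> 0" "\<exists>k. (g ^^ k) x = 0"
  obtains k where "(g ^^ k) x \<noteq> 0" "(g ^^ Suc k) x = 0"
proof -
  let ?m = "LEAST k. (g ^^ k) x = 0"
  have m: "(g ^^ ?m) x = 0" using assms(2) by (rule LeastI_ex)
  then have "?m \<noteq> 0" using assms(1) by (metis funpow_0)
  then obtain k where k: "?m = Suc k" by (metis not0_implies_Suc)
  then have "(g ^^ k) x \<noteq> 0" using not_less_Least[of k "\<lambda>k. (g ^^ k) x = 0"] by auto
  then show thesis using that m k by metis
qed

text \<open>The integrality of Cartan integers. With \<open>v\<close> at the top of the \<open>a\<close>-string through \<open>x\<close>, of weight
  \<open>m = l + k a\<close>, the usual commutation relation says
  \<open>[e, f\<^bsup>i+1\<^esup> v] = (i + 1) (m(\<t> a) - i a(\<t> a) / 2) f\<^bsup>i\<^esup> v\<close>. At the bottom \<open>f\<^bsup>p\<^esup> v\<close> of the string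
  the left-hand side vanishes for \<open>i = p\<close>, so \<open>2 m(\<t> a) = p a(\<t> a)\<close>. The statement avoids
  division and therefore also serves to prove that \<open>a(\<t> a)\<close> is nonzero.\<close>

lemma weight_at_root_vector:
  assumes a: "a \<in> roots \<h>" and x: "wv l x" "x \<noteq> 0"
  shows "\<exists>j::int. 2 * l (\<t> a) = of_int j * a (\<t> a)"
proof -
  obtain e f where e: "wv a e" and f: "wv (\<lambda>h. - a h) f" and t: "\<t> a = br e f"
    and th: "\<t> a \<in> \<h>"
    using root_triple[OF a] by metis
  obtain y where y: "y \<in> \<h>" "a y \<noteq> 0" using root_nonzero[OF a] .
  \<comment> \<open>Raise \<open>x\<close> to the top of its string.\<close>
  obtain k where k: "(br e ^^ k) x \<noteq> 0" "(br e ^^ Suc k) x = 0"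
    using last_nonzero_iterate[OF x(2) iterated_weight_vector_vanishes[OF e x(1) y]] .
  define v where "v = (br e ^^ k) x"
  define m where "m = (\<lambda>h. l h + of_nat k * a h)"
  have wv: "wv m v"
    unfolding m_def v_def by (rule iterated_weight_vector[OF e x(1)])
  have v: "v \<noteq> 0" "br e v = 0" using k by (simp_all add: v_def)
  \<comment> \<open>Lower \<open>v\<close> to the bottom of the string.\<close>
  obtain p where p: "(br f ^^ p) v \<noteq> 0" "(br f ^^ Suc p) v = 0"
    using last_nonzero_iterate[OF v(1) iterated_weight_vector_vanishes[OF f wv y(1)]] y(2) by auto
  define s where "s = \<t> a"
  have wf: "br s ((br f ^^ i) v) = scale (m s - of_nat i * a s) ((br f ^^ i) v)" for i
  proof (induction i)
    case 0
    then show ?case using weight_vectorD[OF wv th] by (simp add: s_def)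
  next
    case (Suc i)
    have "br s f = scale (- a s) f" using weight_vectorD[OF f th] by (simp add: s_def)
    then have "br s ((br f ^^ Suc i) v)
        = scale (- a s) (br f ((br f ^^ i) v))
            + scale (m s - of_nat i * a s) (br f ((br f ^^ i) v))"
      using Suc.IH br_derivation[of s f "(br f ^^ i) v"]
      by (simp only: funpow.simps o_apply br_scale_left br_scale_right)
    also have "\<dots> = scale (- a s + (m s - of_nat i * a s)) (br f ((br f ^^ i) v))"
      by (rule scale_left_distrib[symmetric])
    finally show ?case by (simp add: algebra_simps)
  qed
  have ef: "br e ((br f ^^ Suc i) v) =
    scale (of_nat (Suc i) * (m s - of_nat i * a s / 2)) ((br f ^^ i) v)" for i
  proof (induction i)
    case 0
    show ?case
      using br_derivation[of e f v] v(2) wf[of 0] t by (simp add: s_def)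
  next
    case (Suc i)
    have "br e ((br f ^^ Suc (Suc i)) v) =
      br s ((br f ^^ Suc i) v) + br f (br e ((br f ^^ Suc i) v))"
      using br_derivation[of e f "(br f ^^ Suc i) v"] t by (simp add: s_def)
    also have "\<dots> = scale (m s - of_nat (Suc i) * a s
        + of_nat (Suc i) * (m s - of_nat i * a s / 2)) ((br f ^^ Suc i) v)"
      unfolding Suc.IH wf by (simp add: br_scale_right scale_left_distrib)
    also have "m s - of_nat (Suc i) * a s + of_nat (Suc i) * (m s - of_nat i * a s / 2)
      = of_nat (Suc (Suc i)) * (m s - of_nat (Suc i) * a s / 2)"
      by (simp add: field_simps)
    finally show ?case .
  qed
  have "scale (of_nat (Suc p) * (m s - of_nat p * a s / 2)) ((br f ^^ p) v) = 0"
    using ef[of p] p(2) by simp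
  then have "m s = of_nat p * a s / 2"
    using p(1) by (simp del: of_nat_Suc)
  then have "2 * l s = of_int (int p - 2 * int k) * a s"
    by (simp add: m_def algebra_simps)
  then show ?thesis unfolding s_def by blast
qed

text \<open>Such a \<open>t\<close> commutes with the eigenbasis, hence is central.\<close>

lemma weight_zero_imp_zero:
  assumes "t \<in> \<h>" "\<And>b. b \<in> weight_basis \<Longrightarrow> weight b t = 0"
  shows "t = 0"
proof (rule central_eq_zero)
  fix y
  have "subspace {y. br t y = 0}"
    by (auto simp: subspace_def br_add_right br_scale_right)
  moreover have "weight_basis \<subseteq> {y. br t y = 0}"
    using assms weight_vectorD[OF weight_basis_weight assms(1)] by auto
  ultimately have "span weight_basis \<subseteq> {y. br t y = 0}" by (intro span_minimal)
  then show "br t y = 0" using weight_basis_span by auto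
qed

lemma root_vector_nonzero:
  assumes "a \<in> roots \<h>"
  shows "\<t> a \<noteq> 0"
  using root_nonzero[OF assms] B_root_vector[OF assms] by (metis B_zero_left)

text \<open>If \<open>a(\<t> a) = 0\<close>, the string relation makes every weight vanish at \<open>\<t> a\<close>.\<close>

lemma root_nonisotropic:
  assumes a: "a \<in> roots \<h>"
  shows "a (\<t> a) \<noteq> 0"
proof
  assume "a (\<t> a) = 0"
  then have "weight b (\<t> a) = 0" if "b \<in> weight_basis" for b
    using weight_at_root_vector[OF a weight_basis_weight weight_basis_nonzero] that by force
  then show False
    using weight_zero_imp_zero root_vector_in_cartan[OF a] root_vector_nonzero[OF a] by blast
qed

end

section \<open>The Killing form\<close>

context based_simple_lie_algebra
begin

text \<open>The basis is only a convenience: the trace does not depend on it. What is used is that it is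
  cyclic and easy to evaluate on operators that are diagonal in the eigenbasis.\<close>

definition trace :: "('g \<Rightarrow> 'g) \<Rightarrow> complex" where
  "trace f = (\<Sum>b\<in>weight_basis. representation weight_basis (f b) b)"

lemma representation_linear:
  "representation weight_basis (x + y) b = representation weight_basis x b
      + representation weight_basis y b"
  "representation weight_basis (x - y) b
      = representation weight_basis x b - representation weight_basis y b"
  "representation weight_basis (scale c x) b = c * representation weight_basis x b"
  "representation weight_basis (sum g S) b = (\<Sum>i\<in>S. representation weight_basis (g i) b)"
  using weight_basis_span
  by (simp_all add: representation_add representation_diff representation_scale representation_sum weight_basis_independent)

lemma trace_commute:
  assumes f: "Vector_Spaces.linear scale scale f" and g: "Vector_Spaces.linear scale scale g"
  shows "trace (\<lambda>x. f (g x)) = trace (\<lambda>x. g (f x))"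
proof -
  let ?r = "representation weight_basis"
  have expand: "?r (f (g x)) y = (\<Sum>b\<in>weight_basis. ?r (g x) b * ?r (f b) y)"
    if f: "Vector_Spaces.linear scale scale f" for f g :: "'g \<Rightarrow> 'g" and x y
  proof -
    interpret f: module_hom scale scale f using f by (simp add: module_hom_iff_linear)
    have "g x = (\<Sum>b\<in>weight_basis. scale (?r (g x) b) b)"
      using sum_representation_eq[OF weight_basis_independent _ weight_basis_finite subset_refl, of "g x"]
        weight_basis_span by simp
    then have "f (g x) = (\<Sum>b\<in>weight_basis. scale (?r (g x) b) (f b))"
      by (metis (no_types, lifting) f.sum f.scale sum.cong)
    then show ?thesis by (simp add: representation_linear)
  qed
  show ?thesis
    unfolding trace_def expand[OF f] expand[OF g]
    by (subst sum.swap) (simp add: mult.commute)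
qed

definition killing :: "'g \<Rightarrow> 'g \<Rightarrow> complex" where
  "killing x y = trace (\<lambda>z. br x (br y z))"

lemma killing_sym: "killing x y = killing y x"
  unfolding killing_def by (rule trace_commute[OF br_linear_right br_linear_right])

lemma killing_add_right: "killing x (y + z) = killing x y + killing x z"
  and killing_scale_right: "killing x (scale c y) = c * killing x y"
  unfolding killing_def trace_def
  by (simp_all add: br_add_left br_add_right br_scale_left br_scale_right representation_linear
      sum.distrib sum_distrib_left)

lemma killing_add_left: "killing (x + y) z = killing x z + killing y z"
  and killing_scale_left: "killing (scale c x) z = c * killing x z"
  by (simp_all only: killing_sym[of _ z] killing_add_right killing_scale_right)

lemma killing_br: "killing (br x y) z = killing x (br y z)"
proof -
  have br_br: "br (br u v) w = br u (br v w) - br v (br u w)" for u v w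
    using br_derivation[of u v w] by simp
  have tr_diff: "trace (\<lambda>w. f w - g w) = trace f - trace g" for f g
    by (simp add: trace_def representation_linear sum_subtractf)
  have lin: "Vector_Spaces.linear scale scale (\<lambda>w. br x (br z w))"
    using Vector_Spaces.linear_compose[OF br_linear_right[of z] br_linear_right[of x]] by
        (simp add: o_def)
  have "trace (\<lambda>w. br y (br x (br z w))) = trace (\<lambda>w. br x (br z (br y w)))"
    by (rule trace_commute[OF br_linear_right lin])
  then show ?thesis
    unfolding killing_def br_br br_diff_right tr_diff by simp
qed

lemma killing_invariant: "invariant_form killing"
  unfolding invariant_form_def
proof (intro conjI allI)
  show "Vector_Spaces.linear scale (*) (killing x)" for x
    unfolding module_hom_iff_linear[symmetric] module_hom_def module_hom_axioms_def
    using module_axioms killing_add_right killing_scale_right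
    by (auto simp: Modules.module_def algebra_simps)
qed (fact killing_sym killing_br)+

lemma killing_cartan:
  assumes "x \<in> \<h>" "y \<in> \<h>"
  shows "killing x y = (\<Sum>b\<in>weight_basis. weight b x * weight b y)"
  unfolding killing_def trace_def
proof (rule sum.cong[OF refl])
  fix b assume b: "b \<in> weight_basis"
  have "br x (br y b) = scale (weight b x * weight b y) b"
    using weight_vectorD[OF weight_basis_weight[OF b]] assms by
        (simp add: br_scale_right mult.commute)
  then show "representation weight_basis (br x (br y b)) b = weight b x * weight b y"
    using b by (simp add: representation_linear representation_basis weight_basis_independent)
qed

lemma roots_exist: "\<exists>b\<in>weight_basis. \<exists>h\<in>\<h>. weight b h \<noteq> 0"
proof (rule ccontr)
  assume "\<not> ?thesis"
  then have b: "b \<in> \<h>" if "b \<in> weight_basis" for b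
    using weight_basis_weight[OF that] that
    by (intro h_self_centralizing) (auto simp: weight_vector_def)
  then have "span weight_basis \<subseteq> \<h>"
    using h_subspace by (intro span_minimal) auto
  then have "x \<in> \<h>" for x using weight_basis_span by auto
  then have "br x y = 0" for x y by (intro h_abelian)
  then show False using nonabelian by blast
qed

text \<open>Elements of \<open>dual \<h>\<close> vanish outside \<open>\<h>\<close>, whereas \<open>weight b\<close> is arbitrary there; hence the case
  distinction.\<close>

lemma basis_weight_root:
  assumes b: "b \<in> weight_basis" and h: "h \<in> \<h>" "weight b h \<noteq> 0"
  shows "(\<lambda>y. if y \<in> \<h> then weight b y else 0) \<in> roots \<h>"
proof -
  have bn: "b \<noteq> 0" and bw: "\<And>y. y \<in> \<h> \<Longrightarrow> br y b = scale (weight b y) b"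
    using weight_basis_nonzero[OF b] weight_basis_weight[OF b] by (auto simp: weight_vector_def)
  have add: "weight b (x + y) = weight b x + weight b y" if "x \<in> \<h>" "y \<in> \<h>" for x y
  proof -
    have "scale (weight b (x + y)) b = scale (weight b x + weight b y) b"
      using bw[of "x + y"] bw[of x] bw[of y] that subspace_add[OF h_subspace]
      by (simp add: br_add_left scale_left_distrib)
    then show ?thesis using bn by (metis scale_right_imp_eq)
  qed
  have sc: "weight b (scale c x) = c * weight b x" if "x \<in> \<h>" for c x
  proof -
    have "scale (weight b (scale c x)) b = br (scale c x) b"
      using bw that subspace_scale[OF h_subspace] by simp
    also have "\<dots> = scale (c * weight b x) b"
      using bw that by (simp add: br_scale_left)
    finally have "scale (weight b (scale c x)) b = scale (c * weight b x) b" .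
    then show ?thesis using bn by (metis scale_right_imp_eq)
  qed
  have "(\<lambda>y. if y \<in> \<h> then weight b y else 0) \<in> dual \<h>"
    using h_subspace by (auto simp: dual_def add sc subspace_add subspace_scale)
  moreover have "(\<lambda>y. if y \<in> \<h> then weight b y else 0) \<noteq> (\<lambda>_. 0)"
    using h by (auto simp: fun_eq_iff)
  ultimately show ?thesis
    using bn bw unfolding roots_def by auto
qed

text \<open>Every root is the weight of some basis vector, namely of one that occurs in a root vector.
  Finiteness is what guarantees that a long root exists, and only a long root ties down the
  scale of the standard form.\<close>

lemma roots_finite: "finite (roots \<h>)"
proof (rule finite_subset)
  show "roots \<h> \<subseteq> (\<lambda>b y. if y \<in> \<h> then weight b y else 0) ` weight_basis"
  proof
    fix a assume a: "a \<in> roots \<h>"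
    then obtain x where x: "x \<noteq> 0" "wv a x" by (auto simp: roots_def weight_vector_def)
    let ?r = "representation weight_basis"
    have exp: "(\<Sum>b\<in>weight_basis. scale (?r y b) b) = y" for y
      using sum_representation_eq[OF weight_basis_independent _ weight_basis_finite subset_refl, of y]
        weight_basis_span by simp
    obtain b where b: "b \<in> weight_basis" "?r x b \<noteq> 0"
      using exp[of x] x(1) by (metis (no_types, lifting) scale_zero_left sum.neutral)
    have "weight b y = a y" if y: "y \<in> \<h>" for y
    proof -
      have "br y x = (\<Sum>d\<in>weight_basis. scale (?r x d) (br y d))"
        by (subst exp[of x, symmetric]) (simp add: br_sum_right br_scale_right)
      then have "?r (br y x) b = (\<Sum>d\<in>weight_basis. ?r x d * ?r (br y d) b)"
        by (simp add: representation_linear)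
      also have "\<dots> = (\<Sum>d\<in>weight_basis. if d = b then ?r x b * weight b y else 0)"
        using weight_vectorD[OF weight_basis_weight y]
        by (intro sum.cong)
            (auto simp: representation_linear representation_basis weight_basis_independent)
      also have "\<dots> = ?r x b * weight b y"
        using b(1) weight_basis_finite by simp
      finally show ?thesis
        using b(2) weight_vectorD[OF x(2) y] by (simp add: representation_linear)
    qed
    moreover have "a y = 0" if "y \<notin> \<h>" for y
      using a that by (auto simp: roots_def dual_def)
    ultimately have "a = (\<lambda>y. if y \<in> \<h> then weight b y else 0)" by auto
    then show "a \<in> (\<lambda>b y. if y \<in> \<h> then weight b y else 0) ` weight_basis"
      using b(1) by blast
  qed
qed (simp add: weight_basis_finite)

text \<open>On a simple algebra every invariant form is a multiple of a nondegenerate one. The usual proof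
  takes an eigenvector of the operator relating the forms; here a root vector \<open>e\<close> serves as one.
  The factor \<open>c\<close> is read off from \<open>a(h) \<kappa>(e, b) = \<kappa>(h, [e, b]) = B(e, b) \<kappa>(h, \<t> a)\<close> for \<open>b\<close> of
  weight \<open>- a\<close>. Then the radical of \<open>\<kappa> - c B\<close> is an ideal that contains \<open>e\<close>, so it is the whole
  algebra.\<close>

lemma killing_proportional: "\<exists>c. \<forall>x y. killing x y = c * B x y"
proof -
  obtain a where a: "a \<in> roots \<h>"
    using roots_exist basis_weight_root by metis
  obtain e f where e: "wv a e" "e \<noteq> 0"
    using root_triple[OF a] by metis
  obtain h where h: "h \<in> \<h>" "a h \<noteq> 0" using root_nonzero[OF a] .
  define c where "c = killing h (\<t> a) / a h"
  have ke: "killing e y = c * B e y" for y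
  proof -
    have "killing e y - c * B e y = 0"
    proof (rule linear_eq_zero_on_weight_basis[of "\<lambda>y. killing e y - c * B e y"])
      fix b assume b: "b \<in> weight_basis"
      note wb = weight_basis_weight[OF b]
      show "killing e b - c * B e b = 0"
      proof (cases "\<exists>y\<in>\<h>. a y + weight b y \<noteq> 0")
        case True
        then show ?thesis
          using invariant_orthogonal[OF inv e(1) wb] invariant_orthogonal[OF killing_invariant e(1) wb]
          by auto
      next
        case False
        then have zero: "\<And>y. y \<in> \<h> \<Longrightarrow> weight b y = - a y"
          by (metis add_eq_0_iff)
        have "br e b \<in> \<h>"
          using weight_vector_br[OF e(1) wb] zero
          by (intro h_self_centralizing) (auto simp: weight_vector_def)
        have "br e b - scale (B e b) (\<t> a) = 0"
        proof (rule B_nondegenerate_on_cartan)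
          show "br e b - scale (B e b) (\<t> a) \<in> \<h>"
            using \<open>br e b \<in> \<h>\<close> root_vector_in_cartan[OF a] h_subspace
            by (intro subspace_diff subspace_scale)
          fix y assume y: "y \<in> \<h>"
          have "br b y = scale (a y) b"
            using weight_vectorD[OF wb y] br_antisym[of b y] zero[OF y] by simp
          then show "B (br e b - scale (B e b) (\<t> a)) y = 0"
            by (simp add: B_diff_left B_scale_left B_br B_scale_right B_root_vector[OF a y])
        qed
        then have "killing h (br e b) = B e b * killing h (\<t> a)"
          by (simp add: killing_scale_right)
        moreover have "killing h (br e b) = a h * killing e b"
          using weight_vectorD[OF e(1) h(1)] killing_br[of h e b] killing_scale_left[of "a h" e b]
          by simp
        ultimately show ?thesis
          using h(2) by (simp add: c_def field_simps)
      qed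
    qed (simp_all add: killing_add_right killing_scale_right B_add_right B_scale_right algebra_simps)
    then show ?thesis by simp
  qed
  let ?R = "{x. \<forall>y. killing x y = c * B x y}"
  have "lie_ideal ?R"
    unfolding lie_ideal_def subspace_def
  proof (safe, goal_cases)
    case (1 y)
    then show ?case using killing_scale_left[of 0 0 y] by simp
  next
    case (2 x y z)
    then show ?case by (simp add: killing_add_left B_add_left algebra_simps)
  next
    case (3 d x z)
    then show ?case by (simp add: killing_scale_left B_scale_left)
  next
    case (4 x y z)
    have "br x y = - br y x" by (rule br_antisym)
    then have "br x y = scale (-1) (br y x)" by simp
    then have "killing (br x y) z = - killing (br y x) z" "B (br x y) z = - B (br y x) z"
      using killing_scale_left[of "-1" "br y x" z] B_scale_left[of "-1" "br y x" z] by simp_all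
    then show ?case using 4 by (simp add: killing_br B_br)
  qed
  then have "?R = {0} \<or> ?R = UNIV" by (rule ideals_trivial)
  moreover have "e \<in> ?R" using ke by simp
  ultimately have "?R = UNIV" using e(2) by auto
  then show ?thesis by auto
qed

lemma weight_at_root_vector_real:
  assumes a: "a \<in> roots \<h>" and b: "b \<in> weight_basis"
  obtains j :: int where "weight b (\<t> a) = of_int j / 2 * a (\<t> a)"
  using weight_at_root_vector[OF a weight_basis_weight[OF b] weight_basis_nonzero[OF b]] that
  by (auto simp: field_simps)

text \<open>Evaluating \<open>\<kappa> = c B\<close> at \<open>\<t> a\<close> gives \<open>c a(\<t> a) = a(\<t> a)\<^sup>2 S\<close>, where \<open>S\<close> is a sum of squares of
  halves of integers that do not all vanish, so every \<open>a(\<t> a)\<close> is \<open>c\<close> times a positive real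
  number. For a long root the normalisation says \<open>a(\<t> a) = 2\<close>, which forces \<open>c\<close> to be real and
  positive.\<close>

lemma killing_scalar:
  obtains c :: real where "c > 0" "\<And>x y. killing x y = complex_of_real c * B x y"
    and "\<And>a. a \<in> roots \<h> \<Longrightarrow> \<exists>q::real. q > 0 \<and> a (\<t> a) = complex_of_real q"
proof -
  obtain c where c: "\<And>x y. killing x y = c * B x y"
    using killing_proportional by blast
  have rel: "\<exists>q::real. q > 0 \<and> a (\<t> a) = c * complex_of_real q" if a: "a \<in> roots \<h>" for a
  proof -
    have "\<forall>b\<in>weight_basis. \<exists>j::int. weight b (\<t> a) = of_int j / 2 * a (\<t> a)"
      using weight_at_root_vector_real[OF a] by metis
    then obtain j :: "'g \<Rightarrow> int" where j: "\<And>b. b \<in> weight_basis \<Longrightarrow> weight b (\<t> a) = of_int (j b)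
        / 2 * a (\<t> a)"
      by metis
    define S :: real where "S = (\<Sum>b\<in>weight_basis. (real_of_int (j b) / 2)\<^sup>2)"
    have "c * a (\<t> a) = killing (\<t> a) (\<t> a)"
      using c B_root_vector[OF a root_vector_in_cartan[OF a]] by simp
    also have "\<dots> = (\<Sum>b\<in>weight_basis. (a (\<t> a))\<^sup>2 * of_real ((real_of_int (j b) / 2)\<^sup>2))"
      unfolding killing_cartan[OF root_vector_in_cartan[OF a] root_vector_in_cartan[OF a]]
      by (intro sum.cong) (simp_all add: j power2_eq_square)
    also have "\<dots> = (a (\<t> a))\<^sup>2 * of_real S"
      by (simp add: S_def sum_distrib_left)
    finally have cS: "c = a (\<t> a) * of_real S"
      using root_nonisotropic[OF a] by (simp add: power2_eq_square)
    obtain b where b: "b \<in> weight_basis" "weight b (\<t> a) \<noteq> 0"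
      using weight_zero_imp_zero[OF root_vector_in_cartan[OF a]] root_vector_nonzero[OF a] by blast
    then have "j b \<noteq> 0" using j by auto
    then have "S > 0"
      unfolding S_def using b(1) by (intro sum_pos2[OF weight_basis_finite b(1)]) auto
    then show ?thesis using cS by (intro exI[of _ "1 / S"]) (auto simp: field_simps)
  qed
  obtain a0 where a0: "a0 \<in> roots \<h>"
    using roots_exist basis_weight_root by metis
  have df: "dual_form \<h> B a a = a (\<t> a)" if "a \<in> roots \<h>" for a
    unfolding dual_form_def using B_root_vector[OF that root_vector_in_cartan[OF that]] .
  define M where "M = Max ((\<lambda>a. Re (dual_form \<h> B a a)) ` roots \<h>)"
  have "M \<in> (\<lambda>a. Re (dual_form \<h> B a a)) ` roots \<h>"
    unfolding M_def using roots_finite a0 by (intro Max_in) auto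
  then obtain b where b: "b \<in> roots \<h>" "M = Re (dual_form \<h> B b b)" by auto
  have "long_root \<h> B b"
    unfolding long_root_def b(2)[symmetric] M_def using roots_finite b(1) by auto
  then have "b (\<t> b) = 2"
    using standard df[OF b(1)] by (simp add: standard_form_def)
  then obtain q :: real where q: "q > 0" "2 = c * complex_of_real q"
    using rel[OF b(1)] by auto
  then have cr: "c = complex_of_real (2 / q)" by (simp add: field_simps)
  show thesis
  proof (rule that[of "2 / q"])
    show "2 / q > 0" using q(1) by simp
    show "killing x y = complex_of_real (2 / q) * B x y" for x y
      using c cr by simp
    fix a assume "a \<in> roots \<h>"
    then obtain p :: real where "p > 0" "a (\<t> a) = c * complex_of_real p"
      using rel by blast
    then show "\<exists>q::real. q > 0 \<and> a (\<t> a) = complex_of_real q"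
      using q(1) cr by (intro exI[of _ "2 / q * p"]) auto
  qed
qed

end

section \<open>The Gram matrix of the simple roots\<close>

context based_simple_lie_algebra
begin

lemma simple_root: "i \<in> {1..n} \<Longrightarrow> \<alpha> i \<in> roots \<h>"
  and simple_roots_independent:
    "(\<And>x. (\<Sum>a=1..n. c a * \<alpha> a x) = 0) \<Longrightarrow> i \<in> {1..n} \<Longrightarrow> c i = 0"
  using simple by (auto simp: simple_roots_def)

lemma root_gram_sym: "root_gram \<h> B \<alpha> a b = root_gram \<h> B \<alpha> b a"
  by (simp add: root_gram_def dual_form_def B_sym)

lemma root_gram_integral:
  assumes "a \<in> {1..n}" "b \<in> {1..n}"
  shows "\<exists>j::int. 2 * root_gram \<h> B \<alpha> a b = of_int j * root_gram \<h> B \<alpha> b b"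
proof -
  note a = simple_root[OF assms(1)] and b = simple_root[OF assms(2)]
  obtain e where "wv (\<alpha> a) e" "e \<noteq> 0" using root_triple[OF a] by metis
  then obtain j :: int where j: "2 * \<alpha> a (\<t> (\<alpha> b)) = of_int j * \<alpha> b (\<t> (\<alpha> b))"
    using weight_at_root_vector[OF b] by blast
  have "2 * Re (\<alpha> a (\<t> (\<alpha> b))) = of_int j * Re (\<alpha> b (\<t> (\<alpha> b)))"
    using arg_cong[OF j, of Re] by simp
  then show ?thesis
    unfolding root_gram_def dual_form_def
    using B_root_vector[OF a root_vector_in_cartan[OF b]] B_root_vector[OF b root_vector_in_cartan[OF b]]
    by auto
qed

text \<open>For a real combination \<open>t\<close> of the vectors \<open>\<t> (\<alpha> a)\<close> all weights are real at \<open>t\<close>, so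
  \<open>c B(t, t) = \<kappa>(t, t)\<close> is a sum of squares of real numbers. It vanishes only if \<open>t\<close> is central,
  that is \<open>t = 0\<close>, which the independence of the simple roots excludes.\<close>

lemma root_gram_pos_def:
  fixes v :: "nat \<Rightarrow> real"
  assumes "\<exists>i\<in>{1..n}. v i \<noteq> 0"
  shows "(\<Sum>a=1..n. \<Sum>b=1..n. v a * v b * root_gram \<h> B \<alpha> a b) > 0"
proof -
  obtain c :: real where c: "c > 0" "\<And>x y. killing x y = complex_of_real c * B x y"
    "\<And>a. a \<in> roots \<h> \<Longrightarrow> \<exists>q::real. q > 0 \<and> a (\<t> a) = complex_of_real q"
    using killing_scalar by metis
  define t where "t = (\<Sum>a=1..n. scale (complex_of_real (v a)) (\<t> (\<alpha> a)))"
  have th: "t \<in> \<h>"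
    unfolding t_def using h_subspace simple_root root_vector_in_cartan
    by (intro subspace_sum subspace_scale) auto
  have real_weight: "\<exists>r::real. weight b t = complex_of_real r" if b: "b \<in> weight_basis" for b
  proof -
    have "\<exists>r::real. weight b (\<t> (\<alpha> a)) = complex_of_real r" if a: "a \<in> {1..n}" for a
    proof -
      obtain q where q: "\<alpha> a (\<t> (\<alpha> a)) = complex_of_real q"
        using c(3)[OF simple_root[OF a]] by auto
      obtain j :: int where "weight b (\<t> (\<alpha> a)) = of_int j / 2 * \<alpha> a (\<t> (\<alpha> a))"
        using weight_at_root_vector_real[OF simple_root[OF a] b] .
      then show ?thesis using q by (intro exI[of _ "of_int j / 2 * q"]) simp
    qed
    then obtain r :: "nat \<Rightarrow> real" where r: "\<And>a. a \<in> {1..n} \<Longrightarrow> weight b (\<t> (\<alpha> a))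
        = complex_of_real (r a)"
      by metis
    have "scale (weight b t) b = br t b"
      using weight_vectorD[OF weight_basis_weight[OF b] th] by simp
    also have "\<dots> = (\<Sum>a=1..n. scale (complex_of_real (v a) * complex_of_real (r a)) b)"
      unfolding t_def br_sum_left
    proof (rule sum.cong[OF refl])
      fix a assume a: "a \<in> {1..n}"
      have "br (\<t> (\<alpha> a)) b = scale (complex_of_real (r a)) b"
        using weight_vectorD[OF weight_basis_weight[OF b] root_vector_in_cartan[OF simple_root[OF a]]] r[OF a]
        by simp
      then show "br (scale (complex_of_real (v a)) (\<t> (\<alpha> a))) b
          = scale (complex_of_real (v a) * complex_of_real (r a)) b"
        by (simp add: br_scale_left)
    qed
    also have "\<dots> = scale (complex_of_real (\<Sum>a=1..n. v a * r a)) b"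
      by (simp add: scale_sum_left)
    finally have "weight b t = complex_of_real (\<Sum>a=1..n. v a * r a)"
      using weight_basis_nonzero[OF b] by (metis scale_right_imp_eq)
    then show ?thesis by blast
  qed
  then obtain r where r: "\<And>b. b \<in> weight_basis \<Longrightarrow> weight b t = complex_of_real (r b)"
    by metis
  have "complex_of_real c * B t t = (\<Sum>b\<in>weight_basis. complex_of_real ((r b)\<^sup>2))"
    unfolding c(2)[symmetric] killing_cartan[OF th th]
    by (intro sum.cong) (simp_all add: r power2_eq_square)
  then have Btt: "c * Re (B t t) = (\<Sum>b\<in>weight_basis. (r b)\<^sup>2)"
    by (metis Re_complex_of_real of_real_sum scaleR_complex.simps(1) scaleR_conv_of_real)
  have "t \<noteq> 0"
  proof
    assume "t = 0"
    have "(\<Sum>a=1..n. complex_of_real (v a) * \<alpha> a x) = 0" for x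
    proof (cases "x \<in> \<h>")
      case True
      then have "(\<Sum>a=1..n. complex_of_real (v a) * \<alpha> a x) = B t x"
        unfolding t_def B_sum_left
        by (intro sum.cong) (simp_all add: B_scale_left B_root_vector simple_root)
      then show ?thesis by (simp add: \<open>t = 0\<close>)
    next
      case False
      then have "\<alpha> a x = 0" if "a \<in> {1..n}" for a
        using simple_root[OF that] by (auto simp: roots_def dual_def)
      then show ?thesis by simp
    qed
    then have "\<forall>i\<in>{1..n}. v i = 0"
      using simple_roots_independent[of "\<lambda>a. complex_of_real (v a)"] by auto
    then show False using assms by auto
  qed
  then obtain b where b: "b \<in> weight_basis" "weight b t \<noteq> 0"
    using weight_zero_imp_zero[OF th] by blast
  then have "(\<Sum>b\<in>weight_basis. (r b)\<^sup>2) > 0"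
    using r by (intro sum_pos2[OF weight_basis_finite b(1)]) auto
  then have "Re (B t t) > 0"
    using Btt c(1) by (metis zero_less_mult_pos)
  moreover have "B t t = (\<Sum>a=1..n. \<Sum>b=1..n.
      complex_of_real (v a * v b) * dual_form \<h> B (\<alpha> a) (\<alpha> b))"
    unfolding t_def dual_form_def
    by (simp add: B_sum_left B_sum_right B_scale_left B_scale_right sum_distrib_left mult.assoc,
        subst sum.swap, simp add: mult.left_commute)
  ultimately show ?thesis
    unfolding root_gram_def by simp
qed

end

section \<open>Monomial systems\<close>

definition monomial_solutions ::
    "'i set \<Rightarrow> ('i \<Rightarrow> 'i \<Rightarrow> int) \<Rightarrow> ('i \<Rightarrow> complex) \<Rightarrow> ('i \<Rightarrow> complex) set" where
  "monomial_solutions I M r =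
     {u \<in> I \<rightarrow>\<^sub>E - {0}. \<forall>i\<in>I. (\<Prod>j\<in>I. u j powi M i j) = r i}"

lemma prod_power_int: "(\<Prod>j\<in>S. f j powi k) = (\<Prod>j\<in>S. f j) powi k" for f :: "'i \<Rightarrow> complex"
  by (induction S rule: infinite_finite_induct) (simp_all add: power_int_mult_distrib)

lemma prod_power_int_add:
  fixes u :: "'i \<Rightarrow> complex"
  assumes "\<And>j. j \<in> S \<Longrightarrow> u j \<noteq> 0"
  shows "(\<Prod>j\<in>S. u j powi (p j + q j)) = (\<Prod>j\<in>S. u j powi p j) * (\<Prod>j\<in>S. u j powi q j)"
  unfolding prod.distrib[symmetric] by (intro prod.cong) (simp_all add: assms power_int_add)

text \<open>Adding a multiple of one row of the exponent matrix to another multiplies one equation by a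
  power of another, which is reversible.\<close>

lemma monomial_solutions_row_op:
  assumes "k \<in> I" "l \<in> I" "k \<noteq> l" and r: "\<And>i. i \<in> I \<Longrightarrow> r i \<noteq> 0"
    and M': "\<And>i j. i \<in> I \<Longrightarrow> j \<in> I \<Longrightarrow> M' i j = (if i = k then a * M l j + M k j else M i j)"
  shows "monomial_solutions I M r = monomial_solutions I M' (r(k := r l powi a * r k))"
proof -
  have "(\<forall>i\<in>I. (\<Prod>j\<in>I. u j powi M i j) = r i) \<longleftrightarrow>
        (\<forall>i\<in>I. (\<Prod>j\<in>I. u j powi M' i j) = (r(k := r l powi a * r k)) i)"
    if u: "u \<in> I \<rightarrow>\<^sub>E - {0}" for u :: "'a \<Rightarrow> complex"
  proof -
    have nz: "u j \<noteq> 0" if "j \<in> I" for j using u that by auto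
    have M'k: "(\<Prod>j\<in>I. u j powi M' k j) = (\<Prod>j\<in>I. u j powi M l j) powi a * (\<Prod>j\<in>I. u j powi M k j)"
    proof -
      have "(\<Prod>j\<in>I. u j powi M' k j) = (\<Prod>j\<in>I. u j powi (M l j * a + M k j))"
        using assms(1) by (intro prod.cong) (simp_all add: M' mult.commute)
      also have "\<dots> = (\<Prod>j\<in>I. u j powi (M l j * a)) * (\<Prod>j\<in>I. u j powi M k j)"
        by (rule prod_power_int_add) (rule nz)
      finally show ?thesis by (simp add: power_int_mult prod_power_int)
    qed
    have M'i: "(\<Prod>j\<in>I. u j powi M' i j) = (\<Prod>j\<in>I. u j powi M i j)" if "i \<in> I" "i \<noteq> k" for i
      using that by (intro prod.cong) (simp_all add: M')
    show ?thesis
    proof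
      assume *: "\<forall>i\<in>I. (\<Prod>j\<in>I. u j powi M i j) = r i"
      then show "\<forall>i\<in>I. (\<Prod>j\<in>I. u j powi M' i j) = (r(k := r l powi a * r k)) i"
        using M'k M'i assms(1,2) by simp
    next
      assume *: "\<forall>i\<in>I. (\<Prod>j\<in>I. u j powi M' i j) = (r(k := r l powi a * r k)) i"
      then have **: "(\<Prod>j\<in>I. u j powi M i j) = r i" if "i \<in> I" "i \<noteq> k" for i
        using M'i that by simp
      have "(\<Prod>j\<in>I. u j powi M' k j) = r l powi a * r k"
        using * assms(1) by simp
      then have "r l powi a * (\<Prod>j\<in>I. u j powi M k j) = r l powi a * r k"
        unfolding M'k **[OF assms(2) assms(3)[symmetric]] .
      then have "(\<Prod>j\<in>I. u j powi M k j) = r k"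
        using r[OF assms(2)] by simp
      then show "\<forall>i\<in>I. (\<Prod>j\<in>I. u j powi M i j) = r i"
        using ** by metis
    qed
  qed
  then show ?thesis unfolding monomial_solutions_def by blast
qed

lemma card_power_int_roots:
  assumes "a \<noteq> 0" "c \<noteq> 0"
  shows "finite {z::complex. z \<noteq> 0 \<and> z powi a = c} \<and> card {z::complex. z \<noteq> 0 \<and> z powi a = c}
      = nat \<bar>a\<bar>"
proof -
  define m where "m = nat \<bar>a\<bar>"
  have m: "m > 0" using assms by (simp add: m_def)
  obtain d where d: "d \<noteq> 0" "{z::complex. z \<noteq> 0 \<and> z powi a = c} = {z. z ^ m = d}"
  proof (cases "a > 0")
    case True
    then have "{z::complex. z \<noteq> 0 \<and> z powi a = c} = {z. z ^ m = c}"
      using assms m by (auto simp: m_def power_int_def)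
    then show ?thesis using that assms(2) by blast
  next
    case False
    then have a: "a = - int m" by (simp add: m_def)
    have "{z::complex. z \<noteq> 0 \<and> z powi a = c} = {z. z ^ m = inverse c}"
      using assms m by (auto simp: a power_int_minus zero_power)
    then show ?thesis using that assms(2) by (metis inverse_nonzero_iff_nonzero)
  qed
  have "card {z::complex. z \<noteq> 0 \<and> z powi a = c} = m"
    unfolding d(2) using card_nth_roots[OF d(1) m] .
  then show ?thesis using m by (auto simp: m_def intro: card_ge_0_finite)
qed

text \<open>If \<open>u 0\<close> occurs in equation \<open>p\<close> only, the other equations form a smaller system for the
  remaining unknowns, and each of its solutions extends by the \<open>\<bar>M p 0\<bar>\<close> roots of equation \<open>p\<close>.
  The function \<open>s\<close> enumerates the row indices other than \<open>p\<close>.\<close>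

lemma monomial_solutions_extend:
  fixes M :: "nat \<Rightarrow> nat \<Rightarrow> int"
  assumes p: "p < Suc d" "M p 0 \<noteq> 0" "\<And>i. i < Suc d \<Longrightarrow> i \<noteq> p \<Longrightarrow> M i 0 = 0"
    and r: "\<And>i. i < Suc d \<Longrightarrow> r i \<noteq> 0"
    and s: "s = (\<lambda>i. if i < p then i else Suc i)"
    and S: "S = monomial_solutions {..<d} (\<lambda>i j. M (s i) (Suc j)) (\<lambda>i. r (s i))"
    and fin: "finite S"
  shows "finite (monomial_solutions {..<Suc d} M r)
    \<and> card (monomial_solutions {..<Suc d} M r) = nat \<bar>M p 0\<bar> * card S"
proof -
  note ms = monomial_solutions_def S
  define R where "R v = {z. z \<noteq> 0 \<and> z powi M p 0 = r p / (\<Prod>j<d. v j powi M p (Suc j))}" for v ::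
      "nat \<Rightarrow> complex"
  have vnz: "(\<Prod>j<d. v j powi k j) \<noteq> 0" if "v \<in> S" for v k
    using that by (auto simp: ms PiE_iff)
  have R: "finite (R v) \<and> card (R v) = nat \<bar>M p 0\<bar>" if "v \<in> S" for v
    unfolding R_def using vnz[OF that] r[OF p(1)] by (intro card_power_int_roots[OF p(2)]) simp
  define ext where "ext = (\<lambda>(v, z) j. if j = 0 then z else
      if j < Suc d then v (j - 1) else undefined :: complex)"
  define del where "del u = (\<lambda>j\<in>{..<d}. u (Suc j), u 0)" for u :: "nat \<Rightarrow> complex"
  have split: "(\<Prod>j<Suc d. u j powi k j) = u 0 powi k 0 * (\<Prod>j<d. u (Suc j) powi k (Suc j))"
    for u :: "nat \<Rightarrow> complex" and k
    by (rule prod.lessThan_Suc_shift)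
  have s_range: "s i < Suc d" "s i \<noteq> p" if "i < d" for i using that p(1) by (auto simp: s)
  have s_surj: "\<exists>i'<d. i = s i'" if "i < Suc d" "i \<noteq> p" for i
  proof (cases "i < p")
    case True
    then show ?thesis using p(1) that by (intro exI[of _ i]) (auto simp: s)
  next
    case False
    then show ?thesis using p(1) that by (intro exI[of _ "i - 1"]) (auto simp: s)
  qed
  have "bij_betw ext (SIGMA v:S. R v) (monomial_solutions {..<Suc d} M r)"
  proof (rule bij_betw_byWitness[where f' = del])
    show "\<forall>x\<in>Sigma S R. del (ext x) = x"
      by (auto simp: ext_def del_def fun_eq_iff ms PiE_iff extensional_def)
    show "\<forall>u\<in>monomial_solutions {..<Suc d} M r. ext (del u) = u"
      by (auto simp: ext_def del_def fun_eq_iff ms PiE_iff extensional_def)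
    show "ext ` Sigma S R \<subseteq> monomial_solutions {..<Suc d} M r"
    proof safe
      fix v z assume v: "v \<in> S" and z: "z \<in> R v"
      let ?u = "ext (v, z)"
      have u0: "?u 0 = z" and uS: "j < d \<Longrightarrow> ?u (Suc j) = v j" for j
        by (simp_all add: ext_def)
      have "?u j \<noteq> 0" if "j < Suc d" for j
        using that u0 uS v z by (cases j) (auto simp: R_def ms PiE_iff)
      moreover have "?u \<in> extensional {..<Suc d}"
        by (auto simp: ext_def extensional_def)
      moreover have "(\<Prod>j<Suc d. ?u j powi M i j) = r i" if i: "i < Suc d" for i
      proof (cases "i = p")
        case True
        define Q where "Q = (\<Prod>j<d. v j powi M p (Suc j))"
        have "Q \<noteq> 0" unfolding Q_def by (rule vnz[OF v])
        moreover have "z powi M p 0 = r p / Q" using z by (simp add: R_def Q_def)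
        moreover have "(\<Prod>j<Suc d. ?u j powi M p j) = z powi M p 0 * Q"
          unfolding split u0 Q_def by (simp add: uS)
        ultimately show ?thesis using True by simp
      next
        case False
        then obtain i' where i': "i' < d" "i = s i'" using s_surj i by blast
        then have "(\<Prod>j<d. v j powi M i (Suc j)) = r i"
          using v by (auto simp: ms)
        then show ?thesis using p(3)[OF i False] by (simp add: split uS del: prod.lessThan_Suc)
      qed
      ultimately show "?u \<in> monomial_solutions {..<Suc d} M r"
        by (auto simp: ms PiE_iff simp del: prod.lessThan_Suc)
    qed
    show "del ` monomial_solutions {..<Suc d} M r \<subseteq> Sigma S R"
    proof
      fix x assume "x \<in> del ` monomial_solutions {..<Suc d} M r"
      then obtain u where u: "u \<in> monomial_solutions {..<Suc d} M r" and x: "x = del u" by auto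
      have nz: "u j \<noteq> 0" if "j < Suc d" for j
        using u that by (auto simp: ms PiE_iff)
      have eq: "u 0 powi M i 0 * (\<Prod>j<d. u (Suc j) powi M i (Suc j)) = r i" if "i < Suc d" for i
        using u that unfolding split[symmetric] by
            (simp add: monomial_solutions_def del: prod.lessThan_Suc)
      have "(\<Prod>j<d. u (Suc j) powi M (s i) (Suc j)) = r (s i)" if "i < d" for i
        using eq[OF s_range(1)[OF that]] p(3)[OF s_range[OF that]] by simp
      then have v: "(\<lambda>j\<in>{..<d}. u (Suc j)) \<in> S"
        using nz by (auto simp: ms)
      moreover have "u 0 \<in> R (\<lambda>j\<in>{..<d}. u (Suc j))"
        using eq[OF p(1)] nz by (auto simp: R_def field_simps)
      ultimately show "x \<in> Sigma S R" by (simp add: x del_def)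
    qed
  qed
  moreover have "finite (Sigma S R)" using fin R by (intro finite_SigmaI) auto
  moreover have "card (Sigma S R) = nat \<bar>M p 0\<bar> * card S"
    using fin R by (subst card_SigmaI) auto
  ultimately show ?thesis by (metis bij_betw_finite bij_betw_same_card)
qed

abbreviation square_mat :: "nat \<Rightarrow> (nat \<Rightarrow> nat \<Rightarrow> 'a) \<Rightarrow> 'a mat" where
  "square_mat d M \<equiv> mat d d (\<lambda>(i, j). M i j)"

text \<open>Integer row operations in the manner of Euclid's algorithm, which change neither the solutions
  nor the determinant, clear the first column except for one entry; the sum of the absolute
  values in that column is the measure of termination. Expansion along the column then matches
  \<open>monomial_solutions_extend\<close>.\<close>

lemma card_monomial_solutions_nat:
  assumes "det (square_mat d M) \<noteq> 0" and "\<And>i. i < d \<Longrightarrow> r i \<noteq> 0"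
  shows "finite (monomial_solutions {..<d} M r)
    \<and> card (monomial_solutions {..<d} M r) = nat \<bar>det (square_mat d M)\<bar>"
  using assms
proof (induction d arbitrary: M r)
  case 0
  have "monomial_solutions {..<0} M r = {\<lambda>_. undefined}"
    by (auto simp: monomial_solutions_def)
  then show ?case by (simp add: det_def)
next
  case (Suc d)
  show ?case using Suc.prems
  proof (induction "\<Sum>i<Suc d. nat \<bar>M i 0\<bar>" arbitrary: M r rule: less_induct)
    case less
    let ?A = "square_mat (Suc d) M"
    show ?case
    proof (cases "\<exists>k l. k < Suc d \<and> l < Suc d \<and> k \<noteq> l \<and> M l 0 \<noteq> 0 \<and> \<bar>M l 0\<bar> \<le> \<bar>M k 0\<bar>")
      case True
      then obtain k l where kl: "k < Suc d" "l < Suc d" "k \<noteq> l" "M l 0 \<noteq> 0" "\<bar>M l 0\<bar> \<le> \<bar>M k 0\<bar>"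
        by blast
      define a where "a = - (M k 0 div M l 0)"
      define M' where "M' i j = (if i = k then a * M l j + M k j else M i j)" for i j
      define r' where "r' = r(k := r l powi a * r k)"
      have det: "det (square_mat (Suc d) M') = det ?A"
      proof -
        have "square_mat (Suc d) M' = addrow a k l ?A"
          using kl by (intro eq_matI) (auto simp: M'_def)
        then show ?thesis using kl by (simp add: det_addrow[where n = "Suc d"])
      qed
      have "(\<Sum>i<Suc d. nat \<bar>M' i 0\<bar>) < (\<Sum>i<Suc d. nat \<bar>M i 0\<bar>)"
      proof (rule sum_strict_mono_ex1)
        have "M' k 0 = M k 0 mod M l 0"
          by (simp add: M'_def a_def minus_div_mult_eq_mod[symmetric] algebra_simps)
        then have lt: "\<bar>M' k 0\<bar> < \<bar>M k 0\<bar>"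
          using abs_mod_less[OF kl(4), of "M k 0"] kl(5) by linarith
        then show "\<exists>i\<in>{..<Suc d}. nat \<bar>M' i 0\<bar> < nat \<bar>M i 0\<bar>"
          using kl(1) by (intro bexI[of _ k]) auto
        show "\<forall>i\<in>{..<Suc d}. nat \<bar>M' i 0\<bar> \<le> nat \<bar>M i 0\<bar>"
          using lt by (auto simp: M'_def)
      qed simp
      moreover have "r' i \<noteq> 0" if "i < Suc d" for i
        using less.prems(2) kl that by (simp add: r'_def)
      ultimately have "finite (monomial_solutions {..<Suc d} M' r')
          \<and> card (monomial_solutions {..<Suc d} M' r') = nat \<bar>det (square_mat (Suc d) M')\<bar>"
        using less.prems(1) det by (intro less.hyps) auto
      moreover have "monomial_solutions {..<Suc d} M r = monomial_solutions {..<Suc d} M' r'"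
        unfolding r'_def using kl less.prems(2)
        by (intro monomial_solutions_row_op[where l = l and a = a]) (auto simp: M'_def)
      ultimately show ?thesis using det by simp
    next
      case False
      have laplace: "det ?A = (\<Sum>i<Suc d. M i 0 * cofactor ?A i 0)"
        using laplace_expansion_column[of ?A "Suc d" 0] by simp
      then obtain p where p: "p < Suc d" "M p 0 \<noteq> 0"
        using less.prems(1) by (metis (no_types, lifting) lessThan_iff mult_zero_left sum.neutral)
      have others: "M i 0 = 0" if "i < Suc d" "i \<noteq> p" for i
        using False p that by (metis linorder_linear)
      define s where "s = (\<lambda>i. if i < p then i else Suc i)"
      let ?D = "\<lambda>i j. M (s i) (Suc j)"
      have D: "mat_delete ?A p 0 = square_mat d ?D"
        using p by (intro eq_matI) (auto simp: mat_delete_def s_def)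
      have "det ?A = M p 0 * cofactor ?A p 0"
        unfolding laplace using others p(1) by (subst sum.remove[of _ p]) auto
      then have det: "\<bar>det ?A\<bar> = \<bar>M p 0\<bar> * \<bar>det (square_mat d ?D)\<bar>"
        by (simp add: cofactor_def D abs_mult power_abs)
      have "finite (monomial_solutions {..<d} ?D (\<lambda>i. r (s i)))
          \<and> card (monomial_solutions {..<d} ?D (\<lambda>i. r (s i))) = nat \<bar>det (square_mat d ?D)\<bar>"
        using less.prems det p(1) by (intro Suc.IH) (auto simp: s_def)
      then show ?thesis
        using monomial_solutions_extend[of p d M r s, OF p others less.prems(2) s_def refl] det
        by (simp add: nat_mult_distrib)
    qed
  qed
qed

section \<open>Determinants indexed by finite sets\<close>

lemma set_det_eq_det:
  assumes f: "bij_betw f {..<d} I"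
  shows "set_det I M = det (square_mat d (\<lambda>i j. M (f i) (f j)))"
proof -
  let ?\<phi> = "map_permutation {..<d} f"
  have inj: "inj_on f {..<d}" and fI: "f ` {..<d} = I" using f by (auto simp: bij_betw_def)
  have "bij_betw (\<lambda>\<pi> x. if x \<in> I then f (\<pi> (inv_into {..<d} f x)) else x)
      {\<pi>. \<pi> permutes {..<d}} {\<pi>. \<pi> permutes I}"
    by (rule bij_betw_permutations[OF f])
  also have "(\<lambda>\<pi> x. if x \<in> I then f (\<pi> (inv_into {..<d} f x)) else x) = ?\<phi>"
    using fI by (auto simp: map_permutation_def restrict_id_def fun_eq_iff)
  finally have bij: "bij_betw ?\<phi> {p. p permutes {..<d}} {p. p permutes I}" .
  have "set_det I M = (\<Sum>p | p permutes {..<d}. of_int (sign (?\<phi> p)) * (\<Prod>i\<in>I. M i (?\<phi> p i)))"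
    unfolding set_det_def by (rule sum.reindex_bij_betw[OF bij, symmetric])
  also have "\<dots> = (\<Sum>p | p permutes {..<d}. of_int (sign p) * (\<Prod>i<d. M (f i) (f (p i))))"
  proof (rule sum.cong[OF refl])
    fix p assume "p \<in> {p. p permutes {..<d}}"
    then have p: "p permutes {..<d}" by simp
    have "(\<Prod>i\<in>I. M i (?\<phi> p i)) = (\<Prod>i<d. M (f i) (?\<phi> p (f i)))"
      by (rule prod.reindex_bij_betw[OF f, symmetric])
    also have "\<dots> = (\<Prod>i<d. M (f i) (f (p i)))"
      by (intro prod.cong) (simp_all add: map_permutation_apply[OF inj])
    finally show "of_int (sign (?\<phi> p)) * (\<Prod>i\<in>I. M i (?\<phi> p i)) = of_int (sign p)
        * (\<Prod>i<d. M (f i) (f (p i)))"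
      by (simp add: sign_map_permutation[OF inj p])
  qed
  also have "\<dots> = det (square_mat d (\<lambda>i j. M (f i) (f j)))"
    unfolding det_def
    by (auto intro!: sum.cong prod.cong simp: atLeast0LessThan permutes_in_image dest: permutes_in_image)
  finally show ?thesis .
qed

lemma card_monomial_solutions:
  fixes I :: "'i set"
  assumes fin: "finite I"
    and F: "\<And>i j. i \<in> I \<Longrightarrow> j \<in> I \<Longrightarrow> F i j = of_int (M i j)"
    and det: "set_det I F \<noteq> 0" and r: "\<And>i. i \<in> I \<Longrightarrow> r i \<noteq> 0"
  shows "finite (monomial_solutions I M r)
    \<and> real (card (monomial_solutions I M r)) = \<bar>set_det I F\<bar>"
proof -
  obtain f where f: "bij_betw f {..<card I} I"
    using ex_bij_betw_nat_finite[OF fin] by (auto simp: atLeast0LessThan)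
  let ?d = "card I" and ?M = "\<lambda>i j. M (f i) (f j)"
  have fI: "f i \<in> I" if "i < ?d" for i using f that by (auto simp: bij_betw_def)
  have F_det: "set_det I F = of_int (det (square_mat ?d ?M))"
  proof -
    have "square_mat ?d (\<lambda>i j. F (f i) (f j)) = map_mat of_int (square_mat ?d ?M)"
      by (intro eq_matI) (auto simp: F fI)
    then show ?thesis
      using set_det_eq_det[OF f, of F] by (simp add: of_int_hom.hom_det)
  qed
  have count: "finite (monomial_solutions {..<?d} ?M (\<lambda>i. r (f i)))
      \<and> card (monomial_solutions {..<?d} ?M (\<lambda>i. r (f i))) = nat \<bar>det (square_mat ?d ?M)\<bar>"
    using det F_det fI r by (intro card_monomial_solutions_nat) auto
  let ?g = "inv_into {..<?d} f"
  have g: "?g i < ?d" "f (?g i) = i" if "i \<in> I" for i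
    using f that by (auto simp: bij_betw_def f_inv_into_f inv_into_into[of i f
        "{..<?d}", simplified])
  have gf: "?g (f i) = i" if "i < ?d" for i
    using f that by (simp add: bij_betw_inv_into_left)
  have reindex: "(\<Prod>j<?d. h (f j)) = (\<Prod>j\<in>I. h j)" for h :: "'i \<Rightarrow> complex"
    by (rule prod.reindex_bij_betw[OF f])
  have "bij_betw (\<lambda>u. \<lambda>i\<in>{..<?d}. u (f i)) (monomial_solutions I M r) (monomial_solutions {..<?d} ?M (\<lambda>i. r (f i)))"
  proof (rule bij_betw_byWitness[where f' = "\<lambda>u. \<lambda>i\<in>I. u (?g i)"])
    show "\<forall>u\<in>monomial_solutions I M r. (\<lambda>i\<in>I. (\<lambda>i\<in>{..<?d}. u (f i)) (?g i)) = u"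
      by (auto simp: monomial_solutions_def fun_eq_iff g PiE_iff extensional_def)
    show "\<forall>u\<in>monomial_solutions {..<?d} ?M (\<lambda>i. r (f i)). (\<lambda>i\<in>{..<?d}. (\<lambda>i\<in>I. u (?g i)) (f i)) = u"
      by (auto simp: monomial_solutions_def fun_eq_iff gf fI PiE_iff extensional_def)
    show "(\<lambda>u. \<lambda>i\<in>{..<?d}. u (f i)) ` monomial_solutions I M r
        \<subseteq> monomial_solutions {..<?d} ?M (\<lambda>i. r (f i))"
    proof safe
      fix u assume u: "u \<in> monomial_solutions I M r"
      have "(\<Prod>j<?d. u (f j) powi M (f i) (f j)) = r (f i)" if "i < ?d" for i
        using u fI[OF that] reindex[of "\<lambda>j. u j powi M (f i) j"] by
            (simp add: monomial_solutions_def)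
      then show "(\<lambda>i\<in>{..<?d}. u (f i)) \<in> monomial_solutions {..<?d} ?M (\<lambda>i. r (f i))"
        using u fI by (auto simp: monomial_solutions_def PiE_iff)
    qed
    show "(\<lambda>u. \<lambda>i\<in>I. u (?g i)) ` monomial_solutions {..<?d} ?M (\<lambda>i. r (f i))
        \<subseteq> monomial_solutions I M r"
    proof safe
      fix u assume u: "u \<in> monomial_solutions {..<?d} ?M (\<lambda>i. r (f i))"
      have "(\<Prod>j\<in>I. u (?g j) powi M i j) = r i" if i: "i \<in> I" for i
      proof -
        have "(\<Prod>j\<in>I. u (?g j) powi M i j) = (\<Prod>j<?d. u j powi M (f (?g i)) (f j))"
          unfolding reindex[symmetric] using i by (intro prod.cong) (simp_all add: gf g)
        also have "\<dots> = r (f (?g i))"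
          using u g(1)[OF i] by (auto simp: monomial_solutions_def)
        also have "\<dots> = r i" using g(2)[OF i] by simp
        finally show ?thesis .
      qed
      then show "(\<lambda>i\<in>I. u (?g i)) \<in> monomial_solutions I M r"
        using u g(1) by (auto simp: monomial_solutions_def PiE_iff)
    qed
  qed
  then have "finite (monomial_solutions I M r) \<and> card (monomial_solutions I M r)
      = nat \<bar>det (square_mat ?d ?M)\<bar>"
    using count by (metis bij_betw_finite bij_betw_same_card)
  then show ?thesis unfolding F_det by simp
qed

text \<open>Along the segment from the identity matrix to \<open>M\<close> the quadratic form stays positive, so the
  determinant has no zero, and it starts at \<open>1\<close>.\<close>

lemma set_det_pos:
  fixes M :: "'i \<Rightarrow> 'i \<Rightarrow> real"
  assumes fin: "finite I"
    and pos: "\<And>x. \<exists>i\<in>I. x i \<noteq> 0 \<Longrightarrow> (\<Sum>i\<in>I. \<Sum>j\<in>I. x i * M i j * x j) > 0"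
  shows "set_det I M > 0"
proof (rule ccontr)
  assume "\<not> set_det I M > 0"
  obtain f where f: "bij_betw f {..<card I} I"
    using ex_bij_betw_nat_finite[OF fin] by (auto simp: atLeast0LessThan)
  let ?d = "card I"
  have fI: "f i \<in> I" if "i < ?d" for i using f that by (auto simp: bij_betw_def)
  have inj: "i < ?d \<Longrightarrow> j < ?d \<Longrightarrow> f i = f j \<longleftrightarrow> i = j" for i j
    using f by (auto simp: bij_betw_def inj_on_def)
  define Mt where "Mt t i j = t * M i j + (1 - t) * (if i = j then 1 else 0)" for t i j
  have nz: "set_det I (Mt t) \<noteq> 0" if t: "0 \<le> t" "t \<le> 1" for t
  proof
    let ?A = "square_mat ?d (\<lambda>i j. Mt t (f i) (f j))"
    assume "set_det I (Mt t) = 0"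
    then have "det ?A = 0" by (simp add: set_det_eq_det[OF f])
    then obtain v where v: "v \<in> carrier_vec ?d" "v \<noteq> 0\<^sub>v ?d" "?A *\<^sub>v v = 0\<^sub>v ?d"
      using det_0_iff_vec_prod_zero[of ?A ?d] by auto
    define x where "x i = v $ (inv_into {..<?d} f i)" for i
    have xf: "x (f i) = v $ i" if "i < ?d" for i
      using f that by (simp add: x_def bij_betw_inv_into_left)
    have row: "(\<Sum>j\<in>I. Mt t i j * x j) = 0" if i: "i \<in> I" for i
    proof -
      have "i \<in> f ` {..<?d}" using f i by (simp add: bij_betw_def)
      then obtain k where k: "k < ?d" "i = f k" by auto
      have "(\<Sum>j\<in>I. Mt t i j * x j) = (\<Sum>j<?d. Mt t (f k) (f j) * x (f j))"
        unfolding k(2) by (rule sum.reindex_bij_betw[OF f, symmetric])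
      also have "\<dots> = (?A *\<^sub>v v) $ k"
        using k(1) v(1) by (auto simp: scalar_prod_def xf atLeast0LessThan intro!: sum.cong)
      finally show ?thesis using v(3) k(1) by simp
    qed
    have "\<exists>i<?d. v $ i \<noteq> 0"
      using v(1,2) by (metis carrier_vecD eq_vecI index_zero_vec)
    then have ex: "\<exists>i\<in>I. x i \<noteq> 0" using xf fI by metis
    have "0 = (\<Sum>i\<in>I. x i * (\<Sum>j\<in>I. Mt t i j * x j))" using row by simp
    also have "\<dots> = (\<Sum>i\<in>I. t * (\<Sum>j\<in>I. x i * M i j * x j) + (1 - t) * (x i * x i))"
    proof (rule sum.cong[OF refl])
      fix i assume i: "i \<in> I"
      have "(\<Sum>j\<in>I. Mt t i j * x j) = t * (\<Sum>j\<in>I. M i j * x j) + (1 - t) * (\<Sum>j\<in>I. if i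
          = j then x j else 0)"
        unfolding Mt_def sum_distrib_left sum.distrib[symmetric] by (intro sum.cong)
            (auto simp: algebra_simps)
      also have "(\<Sum>j\<in>I. if i = j then x j else 0) = x i" using fin i by simp
      finally have row_sum: "(\<Sum>j\<in>I. Mt t i j * x j) = t * (\<Sum>j\<in>I. M i j * x j) + (1 - t) * x i" .
      show "x i * (\<Sum>j\<in>I. Mt t i j * x j) = t * (\<Sum>j\<in>I. x i * M i j * x j) + (1 - t) * (x i * x i)"
        unfolding row_sum by (simp add: algebra_simps sum_distrib_left)
    qed
    also have "\<dots> = t * (\<Sum>i\<in>I. \<Sum>j\<in>I. x i * M i j * x j) + (1 - t) * (\<Sum>i\<in>I. x i * x i)"
      by (simp add: sum.distrib sum_distrib_left)
    also have "\<dots> > 0"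
    proof -
      have 1: "(\<Sum>i\<in>I. \<Sum>j\<in>I. x i * M i j * x j) > 0" using pos[OF ex] .
      obtain i where "i \<in> I" "x i \<noteq> 0" using ex by blast
      then have 2: "(\<Sum>i\<in>I. x i * x i) > 0"
        using fin by (intro sum_pos2[of _ i]) (auto simp: zero_less_mult_iff not_less)
      show ?thesis
      proof (cases "t = 0")
        case False
        then show ?thesis using 1 2 t by (intro add_pos_nonneg) auto
      qed (use 2 in simp)
    qed
    finally show False by simp
  qed
  have "set_det I (Mt 0) = 1"
  proof -
    have "square_mat ?d (\<lambda>i j. Mt 0 (f i) (f j)) = 1\<^sub>m ?d"
      by (intro eq_matI) (auto simp: Mt_def inj)
    then show ?thesis by (simp add: set_det_eq_det[OF f])
  qed
  moreover have "Mt 1 = M" by (auto simp: Mt_def fun_eq_iff)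
  moreover have "continuous_on {0..1} (\<lambda>t. set_det I (Mt t))"
    unfolding set_det_def Mt_def by (intro continuous_intros)
  ultimately have "\<exists>t\<ge>0. t \<le> 1 \<and> set_det I (Mt t) = 0"
    using \<open>\<not> set_det I M > 0\<close> by (intro IVT2') auto
  then show False using nz by blast
qed

lemma set_det_scale_columns:
  assumes "finite I"
  shows "set_det I (\<lambda>i j. M i j * c j) = set_det I M * (\<Prod>j\<in>I. c j)"
  unfolding set_det_def sum_distrib_right
proof (rule sum.cong[OF refl])
  fix p assume "p \<in> {p. p permutes I}"
  then have p: "p permutes I" by simp
  have "(\<Prod>i\<in>I. c (p i)) = (\<Prod>j\<in>I. c j)"
    using prod.permute[OF p, of c] by (simp add: o_def)
  then show "of_int (sign p) * (\<Prod>i\<in>I. M i (p i) * c (p i))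
      = of_int (sign p) * (\<Prod>i\<in>I. M i (p i)) * (\<Prod>j\<in>I. c j)"
    by (simp add: prod.distrib)
qed

section \<open>Positivity of the kernel\<close>

text \<open>With \<open>s x\<close> attached to the interval \<open>[0, y x]\<close>, the form is the integral over \<open>\<tau> > 0\<close> of the
  form \<open>g\<close> evaluated at the vector whose entry of index \<open>a\<close> is the sum of the \<open>s x\<close> with
  \<open>c x = a\<close> and \<open>y x \<ge> \<tau>\<close>. The induction cuts this integral at the smallest endpoint \<open>y0\<close>: the
  part below contributes \<open>y0\<close> times the value of \<open>g\<close>, and above it the elements with \<open>y x = y0\<close>
  drop out. Strictness holds because these are the only elements left if \<open>s\<close> vanishes on the
  others, and they have different indices \<open>c x\<close>.\<close>

lemma min_form_pos:
  fixes g :: "'c \<Rightarrow> 'c \<Rightarrow> real" and y :: "'i \<Rightarrow> real"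
  assumes C: "finite C"
    and g: "\<And>v. \<exists>a\<in>C. v a \<noteq> 0 \<Longrightarrow> (\<Sum>a\<in>C. \<Sum>b\<in>C. v a * v b * g a b) > 0"
    and "finite S" "c ` S \<subseteq> C" "\<And>x. x \<in> S \<Longrightarrow> y x > 0" "inj_on (\<lambda>x. (c x, y x)) S"
    and "\<exists>x\<in>S. s x \<noteq> 0"
  shows "(\<Sum>x\<in>S. \<Sum>x'\<in>S. s x * s x' * (g (c x) (c x') * min (y x) (y x'))) > 0"
  using assms(3-)
proof (induction "card S" arbitrary: S y rule: less_induct)
  case less
  note fS = less.prems(1)
  have "S \<noteq> {}" using less.prems(5) by auto
  define y0 where "y0 = Min (y ` S)"
  have y0_in: "y0 \<in> y ` S" and y0_le: "\<And>x. x \<in> S \<Longrightarrow> y0 \<le> y x"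
    unfolding y0_def using fS \<open>S \<noteq> {}\<close> by auto
  then have y0_pos: "y0 > 0" using less.prems(3) by auto
  let ?Q = "\<lambda>S y. \<Sum>x\<in>S. \<Sum>x'\<in>S. s x * s x' * (g (c x) (c x') * min (y x) (y x'))"
  define v where "v a = (\<Sum>x | x \<in> S \<and> c x = a. s x)" for a
  let ?G = "\<Sum>a\<in>C. \<Sum>b\<in>C. v a * v b * g a b"
  have G: "(\<Sum>x\<in>S. \<Sum>x'\<in>S. s x * s x' * g (c x) (c x')) = ?G"
  proof -
    have grp: "(\<Sum>x\<in>S. s x * h (c x)) = (\<Sum>a\<in>C. v a * h a)" for h :: "'c \<Rightarrow> real"
      unfolding v_def sum_distrib_right
      by (subst sum.group[OF fS C less.prems(2), symmetric]) (auto intro!: sum.cong)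
    have "(\<Sum>x\<in>S. \<Sum>x'\<in>S. s x * s x' * g (c x) (c x')) = (\<Sum>x\<in>S. s x * (\<Sum>x'\<in>S. s x' * g (c x) (c x')))"
      by (simp add: sum_distrib_left mult.assoc)
    also have "\<dots> = (\<Sum>x\<in>S. s x * (\<Sum>b\<in>C. v b * g (c x) b))" by (simp add: grp)
    also have "\<dots> = (\<Sum>a\<in>C. v a * (\<Sum>b\<in>C. v b * g a b))" by (rule grp)
    finally show ?thesis by (simp add: sum_distrib_left mult.assoc)
  qed
  have G_nonneg: "?G \<ge> 0"
    using g[of v] by (cases "\<exists>a\<in>C. v a \<noteq> 0") auto
  define S' where "S' = {x \<in> S. y x > y0}"
  have S': "S' \<subseteq> S" "finite S'" using fS by (auto simp: S'_def)
  have out: "y x = y0" if "x \<in> S" "x \<notin> S'" for x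
    using that y0_le[of x] by (auto simp: S'_def)
  have min0: "min (y x - y0) (y x' - y0) = 0" if "x \<in> S" "x' \<in> S" "x \<notin> S' \<or> x' \<notin> S'" for x x'
    using that out y0_le by fastforce
  have decomp: "?Q S y = y0 * ?G + ?Q S' (\<lambda>x. y x - y0)"
  proof -
    have "?Q S y = y0 * (\<Sum>x\<in>S. \<Sum>x'\<in>S. s x * s x' * g (c x) (c x')) + ?Q S (\<lambda>x. y x - y0)"
      unfolding sum_distrib_left sum.distrib[symmetric]
      by (intro sum.cong) (auto simp: algebra_simps min_def)
    also have "?Q S (\<lambda>x. y x - y0) = ?Q S' (\<lambda>x. y x - y0)"
    proof -
      have "(\<Sum>x'\<in>S. s x * s x' * (g (c x) (c x') * min (y x - y0) (y x' - y0)))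
          = (\<Sum>x'\<in>S'. s x * s x' * (g (c x) (c x') * min (y x - y0) (y x' - y0)))" if "x \<in> S" for x
        using that y0_le fS S' by (intro sum.mono_neutral_right) (auto simp: min0)
      then have "?Q S (\<lambda>x. y x - y0) = (\<Sum>x\<in>S. \<Sum>x'\<in>S'. s x * s x'
          * (g (c x) (c x') * min (y x - y0) (y x' - y0)))"
        by simp
      also have "\<dots> = ?Q S' (\<lambda>x. y x - y0)"
        using y0_le fS S' by (intro sum.mono_neutral_right) (auto simp: min0 intro!: sum.neutral)
      finally show ?thesis .
    qed
    finally show ?thesis unfolding G .
  qed
  show ?case
  proof (cases "\<exists>x\<in>S'. s x \<noteq> 0")
    case True
    obtain x0 where "x0 \<in> S" "y x0 = y0" using y0_in by auto
    then have "S' \<subset> S" by (auto simp: S'_def)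
    then have "?Q S' (\<lambda>x. y x - y0) > 0"
      using less.prems True S' psubset_card_mono[OF fS]
      by (intro less.hyps) (auto simp: S'_def inj_on_def)
    then show ?thesis unfolding decomp using G_nonneg y0_pos
      by (intro add_nonneg_pos mult_nonneg_nonneg) auto
  next
    case False
    then obtain x where x: "x \<in> S" "s x \<noteq> 0" "y x = y0"
      using less.prems(5) y0_le by (force simp: S'_def)
    have "v (c x) = s x"
    proof -
      have "v (c x) = (\<Sum>x' | x' \<in> S \<and> c x' = c x. if x' = x then s x else 0)"
        unfolding v_def
      proof (rule sum.cong[OF refl])
        fix x' assume x': "x' \<in> {x' \<in> S. c x' = c x}"
        show "s x' = (if x' = x then s x else 0)"
        proof (cases "y x' = y0")
          case True
          then have "x' = x" using inj_onD[OF less.prems(4), of x' x] x x' by simp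
          then show ?thesis by simp
        next
          case False
          then have "x' \<in> S'" using y0_le x' by (auto simp: S'_def order.order_iff_strict)
          then show ?thesis using \<open>\<not> (\<exists>x\<in>S'. s x \<noteq> 0)\<close> x(2) by auto
        qed
      qed
      then show ?thesis using fS x(1) by simp
    qed
    then have "?G > 0" using x less.prems(2) by (intro g bexI[of _ "c x"]) auto
    moreover have "?Q S' (\<lambda>x. y x - y0) = 0" using False by (intro sum.neutral) auto
    ultimately show ?thesis unfolding decomp using y0_pos by simp
  qed
qed

text \<open>Whichever argument attains the minimum, a factor \<open>t\<close> turns \<open>g\<close> into a Cartan integer.\<close>

lemma kernel_integral:
  assumes g: "g a a > 0" "g b b > 0" "g a b = g b a"
    and "\<exists>j::int. 2 * g a b = of_int j * g b b" "\<exists>j::int. 2 * g b a = of_int j * g a a"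
  shows "kernel g (a, m) (b, k) \<in> \<int>"
proof (cases "tt g b * real m \<le> tt g a * real k")
  case True
  obtain j :: int where "2 * g a b = of_int j * g b b" using assms by blast
  then have "kernel g (a, m) (b, k) = of_int (j * int m)"
    using True g by (simp add: kernel_def tt_def min_def field_simps)
  then show ?thesis by (metis Ints_of_int)
next
  case False
  obtain j :: int where "2 * g b a = of_int j * g a a" using assms by blast
  then have "kernel g (a, m) (b, k) = of_int (j * int k)"
    using False g by (simp add: kernel_def tt_def min_def field_simps)
  then show ?thesis by (metis Ints_of_int)
qed

text \<open>Since \<open>min (t\<^sub>b m) (t\<^sub>a k) = t\<^sub>a t\<^sub>b min (m / t\<^sub>a) (k / t\<^sub>b)\<close>, this is \<open>min_form_pos\<close> for the
  form \<open>g\<close> rescaled by the \<open>t\<^sub>a\<close>.\<close>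

lemma kernel_pos_def:
  assumes C: "finite C" and gpos: "\<And>a. a \<in> C \<Longrightarrow> g a a > 0"
    and g: "\<And>v :: nat \<Rightarrow> real. \<exists>a\<in>C. v a \<noteq> 0 \<Longrightarrow> (\<Sum>a\<in>C. \<Sum>b\<in>C. v a * v b * g a b) > 0"
    and S: "finite S" "\<And>a m. (a, m) \<in> S \<Longrightarrow> a \<in> C \<and> m \<ge> 1"
    and s: "\<exists>x\<in>S. s x \<noteq> 0"
  shows "(\<Sum>x\<in>S. \<Sum>y\<in>S. s x * s y * kernel g x y) > 0"
proof -
  define t where "t = tt g"
  have t: "t a > 0" if "a \<in> C" for a using gpos[OF that] by (simp add: t_def tt_def)
  define y where "y x = real (snd x) / t (fst x)" for x :: "nat \<times> nat"
  have "(\<Sum>x\<in>S. \<Sum>x'\<in>S. s x * s x'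
      * ((\<lambda>a b. t a * t b * g a b) (fst x) (fst x') * min (y x) (y x'))) > 0"
  proof (rule min_form_pos[OF C _ S(1) _ _ _ s])
    show "0 < (\<Sum>a\<in>C. \<Sum>b\<in>C. v a * v b * (t a * t b * g a b))" if "\<exists>a\<in>C. v a \<noteq> 0" for v ::
        "nat \<Rightarrow> real"
    proof -
      have "0 < (\<Sum>a\<in>C. \<Sum>b\<in>C. (v a * t a) * (v b * t b) * g a b)"
        using that t by (intro g) force
      then show ?thesis by (simp add: mult_ac)
    qed
    show "fst ` S \<subseteq> C" using S(2) by auto
    show "y x > 0" if "x \<in> S" for x
      using S(2)[of "fst x" "snd x"] t[of "fst x"] that by (simp add: y_def)
    show "inj_on (\<lambda>x. (fst x, y x)) S"
    proof (rule inj_onI)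
      fix x x' assume x: "x \<in> S" "x' \<in> S" "(fst x, y x) = (fst x', y x')"
      have "t (fst x) > 0" using S(2)[of "fst x" "snd x"] t[of "fst x"] x(1) by simp
      then show "x = x'" using x(3) by (auto simp: y_def prod_eq_iff)
    qed
  qed
  also have "(\<Sum>x\<in>S. \<Sum>x'\<in>S. s x * s x'
      * ((\<lambda>a b. t a * t b * g a b) (fst x) (fst x') * min (y x) (y x')))
    = (\<Sum>x\<in>S. \<Sum>y\<in>S. s x * s y * kernel g x y)"
  proof (intro sum.cong refl)
    fix x x' assume "x \<in> S" "x' \<in> S"
    then have "t (fst x) > 0" "t (fst x') > 0"
      using S(2)[of "fst x" "snd x"] S(2)[of "fst x'" "snd x'"] t by auto
    then have "t (fst x) * t (fst x') * min (y x) (y x')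
        = min (t (fst x') * real (snd x)) (t (fst x) * real (snd x'))"
      by (simp add: y_def min_mult_distrib_left)
    then show "s x * s x' * ((\<lambda>a b. t a * t b * g a b) (fst x) (fst x') * min (y x) (y x'))
        = s x * s x' * kernel g x x'"
      by (cases x; cases x') (simp add: kernel_def t_def mult_ac)
  qed
  finally show ?thesis .
qed

section \<open>Tuples of distinct roots\<close>

text \<open>The off-diagonal solutions of the string center equation, with the unknowns grouped into blocks
  and each equation multiplied by the product over its own block, so that \<open>K\<close> is the only matrix
  of exponents.\<close>

definition distinct_solutions ::
  "'i set \<Rightarrow> ('i \<Rightarrow> nat) \<Rightarrow> ('i \<Rightarrow> nat) \<Rightarrow> ('i \<Rightarrow> 'i \<Rightarrow> int) \<Rightarrow> ('i \<Rightarrow> nat \<Rightarrow> complex) set" where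
  "distinct_solutions I N P K =
     {Z \<in> (\<Pi>\<^sub>E x\<in>I. {1..N x} \<rightarrow>\<^sub>E - {0}).
        (\<forall>x\<in>I. inj_on (Z x) {1..N x}) \<and>
        (\<forall>x\<in>I. \<forall>i\<in>{1..N x}. Z x i ^ (P x + N x) * (\<Prod>y\<in>I. (\<Prod>j=1..N y. Z y j) powi K x y)
           = (- 1) ^ (P x + N x + 1) * (\<Prod>j=1..N x. Z x j))}"

text \<open>The passage from the string center equation to the matrix \<open>F\<close>: \<open>R y\<close> is the product of the roots
  of unity in block \<open>y\<close>, so \<open>u y ^ N y * R y\<close> is the product of the unknowns of that block, and
  of the \<open>p + N x\<close> factors \<open>u x\<close> on the left, \<open>N x\<close> cancel against those on the right.\<close>

lemma monomial_equation_iff: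
  fixes u R :: "'i \<Rightarrow> complex"
  assumes I: "finite I" "x \<in> I" and u: "\<And>y. y \<in> I \<Longrightarrow> u y \<noteq> 0" and R: "\<And>y. y \<in> I \<Longrightarrow> R y \<noteq> 0"
  shows "u x ^ (p + N x) * (\<Prod>y\<in>I. (u y ^ N y * R y) powi k y) = s * (u x ^ N x * R x)
    \<longleftrightarrow> (\<Prod>y\<in>I. u y powi ((if x = y then int p else 0) + k y * int (N y)))
         = s * R x / (\<Prod>y\<in>I. R y powi k y)"
proof -
  define T where "T = (\<Prod>y\<in>I. R y powi k y)"
  define U where "U = (\<Prod>y\<in>I. u y powi (k y * int (N y)))"
  have T: "T \<noteq> 0" using I(1) R by (simp add: T_def)
  have UT: "(\<Prod>y\<in>I. (u y ^ N y * R y) powi k y) = U * T"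
    unfolding U_def T_def prod.distrib[symmetric]
    by (intro prod.cong) (simp_all add: power_int_mult_distrib power_int_power mult.commute)
  have "(\<Prod>y\<in>I. u y powi (if x = y then int p else 0)) = (\<Prod>y\<in>I. if x = y then u x ^ p else 1)"
    by (intro prod.cong) auto
  also have "\<dots> = u x ^ p" using I by simp
  finally have "(\<Prod>y\<in>I. u y powi ((if x = y then int p else 0) + k y * int (N y))) = u x ^ p * U"
    unfolding U_def by (subst prod_power_int_add) (auto simp: u)
  moreover have "u x \<noteq> 0" using u I(2) .
  ultimately show ?thesis
    unfolding UT T_def[symmetric] using T
    by (simp add: power_add field_simps)
qed

lemma card_nontrivial_roots_of_unity:
  assumes "q > 0"
  shows "finite ({z::complex. z ^ q = 1} - {1})" "card ({z::complex. z ^ q = 1} - {1}) = q - 1"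
proof -
  have "card {z::complex. z ^ q = 1} = q" using card_nth_roots[of 1 q] assms by simp
  moreover from this have "finite {z::complex. z ^ q = 1}" using assms card_ge_0_finite by metis
  ultimately show "finite ({z::complex. z ^ q = 1} - {1})" "card ({z::complex. z ^ q = 1} - {1})
      = q - 1"
    by (simp_all add: card_Diff_singleton)
qed

text \<open>Solutions correspond to pairs \<open>(c, u)\<close>: \<open>u x\<close> is the first unknown of block \<open>x\<close>, and \<open>c x i\<close> for
  \<open>i \<ge> 2\<close> is the ratio of the unknown of index \<open>i\<close> to it. The family \<open>c\<close> ranges over a set that
  does not depend on \<open>u\<close>, and the number of admissible \<open>u\<close> is the same for all \<open>c\<close>; only the
  right-hand sides \<open>r c\<close> of their system vary.\<close>

lemma card_distinct_solutions:
  fixes I :: "'i set"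
  assumes I: "finite I" and N: "\<And>x. x \<in> I \<Longrightarrow> N x \<ge> 1"
    and F: "\<And>x y. x \<in> I \<Longrightarrow> y \<in> I \<Longrightarrow>
      F x y = real_of_int ((if x = y then int (P x) else 0) + K x y * int (N y))"
    and det: "set_det I F \<noteq> 0"
  shows "finite (distinct_solutions I N P K)
    \<and> real (card (distinct_solutions I N P K))
      = \<bar>set_det I F\<bar> * (\<Prod>x\<in>I. fact (N x - 1) * (real (P x + N x - 1) gchoose (N x - 1)))"
proof -
  define q where "q x = P x + N x" for x
  define D where "D x = {z::complex. z ^ q x = 1} - {1}" for x
  define E where "E x = {c \<in> {2..N x} \<rightarrow>\<^sub>E D x. inj_on c {2..N x}}" for x
  define R where "R c y = (\<Prod>j=2..N y. c y j)" for c :: "'i \<Rightarrow> nat \<Rightarrow> complex" and y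
  define M where "M x y = (if x = y then int (P x) else 0) + K x y * int (N y)" for x y
  define r where "r c x = (- 1) ^ (q x + 1) * R c x / (\<Prod>y\<in>I. R c y powi K x y)" for c x
  have q: "q x > 0" if "x \<in> I" for x using N[OF that] by (simp add: q_def)
  have D: "finite (D x)" "card (D x) = q x - 1" if "x \<in> I" for x
    unfolding D_def using card_nontrivial_roots_of_unity[OF q[OF that]] by auto
  have D_nz: "z \<noteq> 0" if "x \<in> I" "z \<in> D x" for x z
    using q[OF that(1)] that(2) by (auto simp: D_def power_0_left)
  have E: "finite (E x)" "real (card (E x)) = fact (N x - 1) * (real (P x
      + N x - 1) gchoose (N x - 1))"
    if x: "x \<in> I" for x
  proof -
    show "finite (E x)"
      unfolding E_def using D(1)[OF x] by (simp add: finite_PiE)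
    have "card (E x) = (\<Prod>i=0..<N x - 1. q x - 1 - i)"
      unfolding E_def using card_inj_on_subset_funcset[of "{2..N x}" "D x"
          "{2..N x}"] D[OF x] N[OF x]
      by simp
    then have "real (card (E x)) = (\<Prod>i=0..<N x - 1. real (q x - 1) - real i)"
      unfolding of_nat_prod using N[OF x]
      by simp (intro prod.cong, auto simp: q_def of_nat_diff)
    also have "\<dots> = fact (N x - 1) * (real (q x - 1) gchoose (N x - 1))"
      by (simp add: gbinomial_mult_fact)
    finally show "real (card (E x)) = fact (N x - 1) * (real (P x + N x - 1) gchoose (N x - 1))"
      by (simp add: q_def)
  qed
  have R_nz: "R c y \<noteq> 0" if "c \<in> Pi\<^sub>E I E" "y \<in> I" for c y
    unfolding R_def using that D_nz[OF that(2)] by (auto simp: E_def PiE_iff)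
  have r_nz: "r c x \<noteq> 0" if "c \<in> Pi\<^sub>E I E" "x \<in> I" for c x
    unfolding r_def using R_nz[OF that(1)] that(2) I by simp
  have count: "finite (monomial_solutions I M (r c))
      \<and> real (card (monomial_solutions I M (r c))) = \<bar>set_det I F\<bar>" if "c \<in> Pi\<^sub>E I E" for c
    using r_nz[OF that] F det by (intro card_monomial_solutions[OF I]) (auto simp: M_def)
  define \<Phi> where "\<Phi> = (\<lambda>(c, u). \<lambda>x\<in>I. \<lambda>i\<in>{1..N x}. (u x :: complex) * (if i = 1 then 1 else c x i))"
  define \<Psi> where "\<Psi> Z = (\<lambda>x\<in>I. \<lambda>i\<in>{2..N x}. Z x i / Z x 1, \<lambda>x\<in>I. (Z x 1 :: complex))" for Z
  have prod_split: "(\<Prod>j=1..N y. f j) = f 1 * (\<Prod>j=2..N y. f j)" if "y \<in> I" for f :: "nat \<Rightarrow> complex"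
      and y
    using N[OF that] by (subst prod.atLeast_Suc_atMost) (auto simp: numeral_2_eq_2)
  have prod_Z: "(\<Prod>j=1..N y. u y * (if j = 1 then 1 else c y j)) = u y ^ N y * R c y"
    if y: "y \<in> I" for u :: "'i \<Rightarrow> complex" and c y
  proof -
    have "(\<Prod>j=1..N y. if j = 1 then 1 else c y j) = R c y"
      unfolding prod_split[OF y] R_def by simp
    then show ?thesis by (simp add: prod.distrib)
  qed
  have "bij_betw \<Phi> (SIGMA c:Pi\<^sub>E I E. monomial_solutions I M (r c)) (distinct_solutions I N P K)"
  proof (rule bij_betw_byWitness[where f' = \<Psi>])
    show "\<forall>p\<in>Sigma (Pi\<^sub>E I E) (\<lambda>c. monomial_solutions I M (r c)). \<Psi> (\<Phi> p) = p"
    proof safe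
      fix c u assume c: "c \<in> Pi\<^sub>E I E" and u: "u \<in> monomial_solutions I M (r c)"
      have "u x \<noteq> 0" if "x \<in> I" for x using u that by (auto simp: monomial_solutions_def PiE_iff)
      then have "(\<lambda>x\<in>I. \<lambda>i\<in>{2..N x}. \<Phi> (c, u) x i / \<Phi> (c, u) x 1) = c"
        using c N by (force simp: \<Phi>_def fun_eq_iff PiE_iff E_def extensional_def)
      moreover have "(\<lambda>x\<in>I. \<Phi> (c, u) x 1) = u"
        using u N by (auto simp: \<Phi>_def fun_eq_iff monomial_solutions_def PiE_iff extensional_def)
      ultimately show "\<Psi> (\<Phi> (c, u)) = (c, u)" by (simp add: \<Psi>_def)
    qed
    show "\<forall>Z\<in>distinct_solutions I N P K. \<Phi> (\<Psi> Z) = Z"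
    proof (intro ballI ext)
      fix Z x i assume Z: "Z \<in> distinct_solutions I N P K"
      show "\<Phi> (\<Psi> Z) x i = Z x i"
      proof (cases "x \<in> I \<and> i \<in> {1..N x}")
        case True
        then have "Z x 1 \<noteq> 0" using Z by (auto simp: distinct_solutions_def PiE_iff)
        then show ?thesis using True by (auto simp: \<Phi>_def \<Psi>_def)
      next
        case False
        then show ?thesis using Z by
            (auto simp: \<Phi>_def \<Psi>_def distinct_solutions_def PiE_iff extensional_def)
      qed
    qed
    show "\<Phi> ` Sigma (Pi\<^sub>E I E) (\<lambda>c. monomial_solutions I M (r c)) \<subseteq> distinct_solutions I N P K"
    proof safe
      fix c u assume c: "c \<in> Pi\<^sub>E I E" and u: "u \<in> monomial_solutions I M (r c)"
      have unz: "u x \<noteq> 0" if "x \<in> I" for x using u that by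
          (auto simp: monomial_solutions_def PiE_iff)
      have cE: "c x i \<in> D x" if "x \<in> I" "i \<in> {1..N x}" "i \<noteq> 1" for x i
        using c that by (auto simp: E_def PiE_iff)
      have Z: "\<Phi> (c, u) x i = u x * (if i = 1 then 1 else c x i)" if "x \<in> I" "i \<in> {1..N x}" for x i
        using that by (simp add: \<Phi>_def)
      have "\<Phi> (c, u) \<in> (\<Pi>\<^sub>E x\<in>I. {1..N x} \<rightarrow>\<^sub>E - {0})"
        using unz cE D_nz by (auto simp: \<Phi>_def)
      moreover have "inj_on (\<Phi> (c, u) x) {1..N x}" if x: "x \<in> I" for x
      proof (rule inj_onI)
        fix i j assume ij: "i \<in> {1..N x}" "j \<in> {1..N x}" "\<Phi> (c, u) x i = \<Phi> (c, u) x j"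
        then have eq: "(if i = 1 then 1 else c x i) = (if j = 1 then 1 else c x j)"
          using Z x unz by simp
        have "inj_on (c x) {2..N x}" using c x by (auto simp: E_def PiE_iff)
        moreover have "c x k \<noteq> 1" if "k \<in> {1..N x}" "k \<noteq> 1" for k
          using cE[OF x that] by (simp add: D_def)
        ultimately show "i = j"
          using eq ij(1,2) by (cases "i = 1"; cases "j = 1")
              (auto dest: inj_onD simp: eq_commute[of 1])
      qed
      moreover have "\<Phi> (c, u) x i ^ (P x + N x) * (\<Prod>y\<in>I. (\<Prod>j=1..N y. \<Phi> (c, u) y j) powi K x y)
           = (- 1) ^ (P x + N x + 1) * (\<Prod>j=1..N x. \<Phi> (c, u) x j)" if x: "x \<in> I" and i: "i
               \<in> {1..N x}" for x i
      proof -
        have prodZ: "(\<Prod>j=1..N y. \<Phi> (c, u) y j) = u y ^ N y * R c y" if "y \<in> I" for y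
          unfolding prod_Z[OF that, symmetric] by (intro prod.cong) (simp_all add: Z that)
        have "\<Phi> (c, u) x i ^ (P x + N x) = u x ^ (P x + N x)"
          using cE[OF x i] Z[OF x i] by (auto simp: D_def q_def power_mult_distrib)
        moreover have "(\<Prod>y\<in>I. u y powi M x y) = r c x"
          using u x by (simp add: monomial_solutions_def)
        then have "u x ^ (P x + N x) * (\<Prod>y\<in>I. (u y ^ N y * R c y) powi K x y)
            = (- 1) ^ (P x + N x + 1) * (u x ^ N x * R c x)"
          unfolding M_def r_def q_def
          by (subst monomial_equation_iff[OF I x unz R_nz[OF c]]) auto
        moreover have "(\<Prod>y\<in>I. (\<Prod>j=1..N y. \<Phi> (c, u) y j) powi K x y)
            = (\<Prod>y\<in>I. (u y ^ N y * R c y) powi K x y)"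
          by (intro prod.cong refl) (simp only: prodZ)
        ultimately show ?thesis by (simp only: prodZ[OF x])
      qed
      ultimately show "\<Phi> (c, u) \<in> distinct_solutions I N P K"
        by (auto simp: distinct_solutions_def)
    qed
    show "\<Psi> ` distinct_solutions I N P K \<subseteq> Sigma (Pi\<^sub>E I E) (\<lambda>c. monomial_solutions I M (r c))"
    proof (rule image_subsetI)
      fix Z assume Z: "Z \<in> distinct_solutions I N P K"
      have Znz: "Z x i \<noteq> 0" if "x \<in> I" "i \<in> {1..N x}" for x i
        using Z that by (auto simp: distinct_solutions_def PiE_iff)
      define c where "c = (\<lambda>x\<in>I. \<lambda>i\<in>{2..N x}. Z x i / Z x 1)"
      define u where "u = (\<lambda>x\<in>I. Z x 1)"
      have one: "1 \<in> {1..N x}" if "x \<in> I" for x using N[OF that] by simp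
      have unz: "u x \<noteq> 0" if "x \<in> I" for x using that Znz one by (simp add: u_def)
      have Z_eq: "Z x i = u x * (if i = 1 then 1 else c x i)" if "x \<in> I" "i \<in> {1..N x}" for x i
        using that Znz[OF that(1) one[OF that(1)]] by (auto simp: u_def c_def)
      have prodZ: "(\<Prod>j=1..N y. Z y j) = u y ^ N y * R c y" if "y \<in> I" for y
        unfolding prod_Z[OF that, symmetric] by (intro prod.cong) (simp_all add: Z_eq that)
      have eqn: "Z x i ^ q x * (\<Prod>y\<in>I. (\<Prod>j=1..N y. Z y j) powi K x y)
           = (- 1) ^ (q x + 1) * (\<Prod>j=1..N x. Z x j)" if "x \<in> I" "i \<in> {1..N x}" for x i
        using Z that by (simp add: distinct_solutions_def q_def)
      \<comment> \<open>The equations within a block differ only in the power on the left.\<close>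
      have pow: "Z x i ^ q x = Z x 1 ^ q x" if x: "x \<in> I" and i: "i \<in> {1..N x}" for x i
      proof -
        have "(\<Prod>y\<in>I. (\<Prod>j=1..N y. Z y j) powi K x y) \<noteq> 0"
          using I Znz by auto
        moreover have "Z x i ^ q x * (\<Prod>y\<in>I. (\<Prod>j=1..N y. Z y j) powi K x y)
            = Z x 1 ^ q x * (\<Prod>y\<in>I. (\<Prod>j=1..N y. Z y j) powi K x y)"
          unfolding eqn[OF x i] eqn[OF x one[OF x]] ..
        ultimately show ?thesis by simp
      qed
      have "c x \<in> E x" if x: "x \<in> I" for x
      proof -
        have inj: "inj_on (Z x) {1..N x}" using Z x by (simp add: distinct_solutions_def)
        have Z1: "Z x 1 \<noteq> 0" using Znz[OF x one[OF x]] .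
        have "c x i \<in> D x" if i: "i \<in> {2..N x}" for i
        proof -
          have "Z x i \<noteq> Z x 1" using inj_onD[OF inj, of i 1] i by auto
          moreover have "Z x i ^ q x = Z x 1 ^ q x" using i by (intro pow[OF x]) auto
          ultimately show ?thesis using Z1 x i by (simp add: D_def c_def power_divide)
        qed
        moreover have "inj_on (c x) {2..N x}"
        proof (rule inj_onI)
          fix i j assume "i \<in> {2..N x}" "j \<in> {2..N x}" "c x i = c x j"
          then show "i = j" using inj_onD[OF inj, of i j] Z1 x by (simp add: c_def)
        qed
        ultimately show ?thesis using x by (auto simp: E_def c_def)
      qed
      then have c: "c \<in> Pi\<^sub>E I E" by (auto simp: c_def)
      have "(\<Prod>y\<in>I. u y powi M x y) = r c x" if x: "x \<in> I" for x
      proof -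
        have "u x ^ (P x + N x) * (\<Prod>y\<in>I. (u y ^ N y * R c y) powi K x y)
            = (- 1) ^ (P x + N x + 1) * (u x ^ N x * R c x)"
        proof -
          have "(\<Prod>y\<in>I. (\<Prod>j=1..N y. Z y j) powi K x y) = (\<Prod>y\<in>I. (u y ^ N y * R c y) powi K x y)"
            by (intro prod.cong refl) (simp only: prodZ)
          moreover have "Z x 1 = u x" using x by (simp add: u_def)
          ultimately show ?thesis
            using eqn[OF x one[OF x]] by (simp only: prodZ[OF x] q_def)
        qed
        then show ?thesis
          unfolding M_def r_def q_def
          by (subst (asm) monomial_equation_iff[OF I x unz R_nz[OF c]]) auto
      qed
      then have "u \<in> monomial_solutions I M (r c)"
        using unz by (auto simp: monomial_solutions_def u_def)
      with c show "\<Psi> Z \<in> Sigma (Pi\<^sub>E I E) (\<lambda>c. monomial_solutions I M (r c))"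
        by (simp add: \<Psi>_def c_def u_def)
    qed
  qed
  moreover have fE: "finite (Pi\<^sub>E I E)" using I E(1) by (simp add: finite_PiE)
  moreover have "finite (Sigma (Pi\<^sub>E I E) (\<lambda>c. monomial_solutions I M (r c)))"
    using fE count by (intro finite_SigmaI) auto
  moreover have "real (card (Sigma (Pi\<^sub>E I E) (\<lambda>c. monomial_solutions I M (r c))))
      = \<bar>set_det I F\<bar> * real (card (Pi\<^sub>E I E))"
    using fE count by (subst card_SigmaI) auto
  moreover have "real (card (Pi\<^sub>E I E)) = (\<Prod>x\<in>I. real (card (E x)))"
    using I by (simp add: card_PiE)
  ultimately show ?thesis
    using E(2) by (simp add: bij_betw_finite bij_betw_same_card[symmetric])
qed

section \<open>The string center equation\<close>

text \<open>Evaluates the left-hand side of a string center equation in terms of block products.\<close>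

lemma exponent_product:
  fixes Z :: "'i \<Rightarrow> nat \<Rightarrow> complex"
  assumes I: "finite I" "x \<in> I" and i: "i \<in> {1..N x}"
    and Z: "\<And>y j. y \<in> I \<Longrightarrow> j \<in> {1..N y} \<Longrightarrow> Z y j \<noteq> 0"
  shows "(\<Prod>y\<in>I. \<Prod>j=1..N y. Z y j powi ((if x = y \<and> i = j then int q else 0) + k y - (if x
      = y then 1 else 0)))
    = Z x i ^ q * (\<Prod>y\<in>I. (\<Prod>j=1..N y. Z y j) powi k y) / (\<Prod>j=1..N x. Z x j)"
proof -
  have "(\<Prod>y\<in>I. \<Prod>j=1..N y. Z y j powi ((if x = y \<and> i = j then int q else 0) + k y - (if x
      = y then 1 else 0)))
    = (\<Prod>y\<in>I. (\<Prod>j=1..N y. if x = y \<and> i = j then Z x i ^ q else 1)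
        * (\<Prod>j=1..N y. Z y j) powi k y / (if x = y then \<Prod>j=1..N x. Z x j else 1))"
  proof (rule prod.cong[OF refl])
    fix y assume y: "y \<in> I"
    have "(\<Prod>j=1..N y. Z y j powi ((if x = y \<and> i = j then int q else 0) + k y - (if x
        = y then 1 else 0)))
      = (\<Prod>j=1..N y. (if x = y \<and> i = j then Z x i ^ q else 1) * Z y j powi k y / (if x
          = y then Z x j else 1))"
      using Z[OF y] by (intro prod.cong) (auto simp: power_int_add power_int_diff)
    then show "(\<Prod>j=1..N y. Z y j powi ((if x = y \<and> i = j then int q else 0) + k y - (if x
        = y then 1 else 0)))
      = (\<Prod>j=1..N y. if x = y \<and> i = j then Z x i ^ q else 1)
        * (\<Prod>j=1..N y. Z y j) powi k y / (if x = y then \<Prod>j=1..N x. Z x j else 1)"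
      by (simp add: prod.distrib prod_dividef prod_power_int)
  qed
  also have "\<dots> = (\<Prod>y\<in>I. \<Prod>j=1..N y. if x = y \<and> i = j then Z x i ^ q else 1)
      * (\<Prod>y\<in>I. (\<Prod>j=1..N y. Z y j) powi k y) / (\<Prod>j=1..N x. Z x j)"
    using I by (simp add: prod.distrib prod_dividef)
  also have "(\<Prod>y\<in>I. \<Prod>j=1..N y. if x = y \<and> i = j then Z x i ^ q else 1) = (\<Prod>y\<in>I. if x
      = y then Z x i ^ q else 1)"
    using i by (intro prod.cong) (auto simp: prod.If_cases)
  also have "\<dots> = Z x i ^ q" using I by simp
  finally show ?thesis .
qed

lemma off_diagonal_solutions_bij:
  fixes P :: "nat \<times> nat \<Rightarrow> nat" and K :: "nat \<times> nat \<Rightarrow> nat \<times> nat \<Rightarrow> int"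
  assumes fin: "finite (supp N)"
    and P: "\<And>a m. (a, m) \<in> supp N \<Longrightarrow> PP g \<nu> N a m = real (P (a, m))"
    and K: "\<And>x y. x \<in> supp N \<Longrightarrow> y \<in> supp N \<Longrightarrow> kernel g x y = of_int (K x y)"
  shows "bij_betw (\<lambda>z. \<lambda>x\<in>supp N. \<lambda>i\<in>{1..case_prod N x}. z (fst x, snd x, i))
    (off_diagonal_solutions g \<nu> N) (distinct_solutions (supp N) (case_prod N) P K)"
proof -
  let ?N = "case_prod N" and ?I = "supp N"
  let ?\<Phi> = "\<lambda>z::nat \<times> nat \<times> nat \<Rightarrow> complex. \<lambda>x\<in>?I. \<lambda>i\<in>{1..?N x}. z (fst x, snd x, i)"
  let ?\<Psi> = "\<lambda>Z. \<lambda>(a, m, i)\<in>unknowns N. Z (a, m) i :: complex"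
  have unk: "(a, m, i) \<in> unknowns N \<longleftrightarrow> (a, m) \<in> ?I \<and> i \<in> {1..?N (a, m)}" for a m i
    by (auto simp: unknowns_def)
  have AA: "\<lfloor>AA g \<nu> N (a, m, i) (b, k, j)\<rfloor> = (if (a, m) = (b, k) \<and> i = j then int (P (a, m)
      + ?N (a, m)) else 0)
      + K (a, m) (b, k) - (if (a, m) = (b, k) then 1 else 0)"
    if "(a, m) \<in> ?I" "(b, k) \<in> ?I" for a m i b k j
  proof -
    have "AA g \<nu> N (a, m, i) (b, k, j) = real_of_int ((if (a, m) = (b, k) \<and> i
        = j then int (P (a, m) + ?N (a, m)) else 0)
      + K (a, m) (b, k) - (if (a, m) = (b, k) then 1 else 0))"
      using that by (auto simp: AA_def P K)
    then show ?thesis by (simp only: floor_of_int)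
  qed
  have PPN: "(- 1 :: complex) powi \<lfloor>PP g \<nu> N a m + real (N a m) + 1\<rfloor> = (- 1) ^ (P (a, m)
      + ?N (a, m) + 1)"
    if "(a, m) \<in> ?I" for a m
  proof -
    have "PP g \<nu> N a m + real (N a m) + 1 = real_of_int (int (P (a, m) + ?N (a, m) + 1))"
      using P[OF that] by simp
    then have "\<lfloor>PP g \<nu> N a m + real (N a m) + 1\<rfloor> = int (P (a, m) + ?N (a, m) + 1)"
      by (simp only: floor_of_int)
    then show ?thesis by (simp only: power_int_of_nat)
  qed
  have equation: "(\<Prod>(b, k)\<in>?I. \<Prod>j=1..N b k. z (b, k, j) powi \<lfloor>AA g \<nu> N (a, m, i) (b, k, j)\<rfloor>)
        = (- 1) powi \<lfloor>PP g \<nu> N a m + real (N a m) + 1\<rfloor>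
      \<longleftrightarrow> ?\<Phi> z (a, m) i ^ (P (a, m) + ?N (a, m)) * (\<Prod>y\<in>?I. (\<Prod>j=1..?N y. ?\<Phi> z y j) powi K (a, m) y)
        = (- 1) ^ (P (a, m) + ?N (a, m) + 1) * (\<Prod>j=1..?N (a, m). ?\<Phi> z (a, m) j)"
    if z: "\<And>t. t \<in> unknowns N \<Longrightarrow> z t \<noteq> 0" and t: "(a, m) \<in> ?I" "i \<in> {1..?N (a, m)}" for z a m i
  proof -
    have nz: "?\<Phi> z y j \<noteq> 0" if "y \<in> ?I" "j \<in> {1..?N y}" for y j
      using z[of "(fst y, snd y, j)"] that by (cases y) (simp add: unk)
    have "(\<Prod>(b, k)\<in>?I. \<Prod>j=1..N b k. z (b, k, j) powi \<lfloor>AA g \<nu> N (a, m, i) (b, k, j)\<rfloor>)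
      = (\<Prod>y\<in>?I. \<Prod>j=1..?N y. ?\<Phi> z y j powi ((if (a, m) = y \<and> i = j then int (P (a, m)
          + ?N (a, m)) else 0)
          + K (a, m) y - (if (a, m) = y then 1 else 0)))"
    proof (rule prod.cong[OF refl])
      fix y assume y: "y \<in> ?I"
      obtain b k where bk: "y = (b, k)" by (cases y)
      have "z (b, k, j) powi \<lfloor>AA g \<nu> N (a, m, i) (b, k, j)\<rfloor>
        = ?\<Phi> z y j powi ((if (a, m) = y \<and> i = j then int (P (a, m) + ?N (a, m)) else 0)
          + K (a, m) y - (if (a, m) = y then 1 else 0))" if "j \<in> {1..N b k}" for j
        unfolding AA[OF t(1) y[unfolded bk]] using that y by (simp add: bk)
      then show "(case y of (b, k) \<Rightarrow> \<Prod>j=1..N b k. z (b, k, j) powi \<lfloor>AA g \<nu> N (a, m, i) (b, k, j)\<rfloor>)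
        = (\<Prod>j=1..?N y. ?\<Phi> z y j powi ((if (a, m) = y \<and> i = j then int (P (a, m) + ?N (a, m)) else 0)
          + K (a, m) y - (if (a, m) = y then 1 else 0)))"
        unfolding bk split_conv by (intro prod.cong refl)
    qed
    also have "\<dots> = ?\<Phi> z (a, m) i ^ (P (a, m) + ?N (a, m))
        * (\<Prod>y\<in>?I. (\<Prod>j=1..?N y. ?\<Phi> z y j) powi K (a, m) y)
        / (\<Prod>j=1..?N (a, m). ?\<Phi> z (a, m) j)"
      by (rule exponent_product[where Z = "?\<Phi> z" and N = ?N, OF fin t nz])
    finally have lhs: "(\<Prod>(b, k)\<in>?I. \<Prod>j=1..N b k. z (b, k, j) powi \<lfloor>AA g \<nu> N (a, m, i) (b, k, j)\<rfloor>)
      = ?\<Phi> z (a, m) i ^ (P (a, m) + ?N (a, m)) * (\<Prod>y\<in>?I. (\<Prod>j=1..?N y. ?\<Phi> z y j) powi K (a, m) y)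
        / (\<Prod>j=1..?N (a, m). ?\<Phi> z (a, m) j)" .
    have "(\<Prod>j=1..?N (a, m). ?\<Phi> z (a, m) j) \<noteq> 0"
      using nz[OF t(1)] unfolding prod_zero_iff[OF finite_atLeastAtMost] by blast
    then show ?thesis unfolding lhs PPN[OF t(1)] by (rule nonzero_divide_eq_eq)
  qed
  have \<Phi>_off: "inj_on (?\<Phi> z (a, m)) {1..?N (a, m)} \<longleftrightarrow> inj_on (\<lambda>i. z (a, m, i)) {1..N a m}"
    if "(a, m) \<in> ?I" for z a m
    using that by (auto simp: inj_on_def)
  have equiv: "z \<in> off_diagonal_solutions g \<nu> N \<longleftrightarrow> ?\<Phi> z \<in> distinct_solutions ?I ?N P K"
    if z: "z \<in> extensional (unknowns N)" for z
  proof (cases "\<forall>t\<in>unknowns N. z t \<noteq> 0")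
    case True
    then have "z \<in> unknowns N \<rightarrow>\<^sub>E - {0}" using z by (auto simp: PiE_iff)
    moreover have "?\<Phi> z \<in> (\<Pi>\<^sub>E x\<in>?I. {1..?N x} \<rightarrow>\<^sub>E - {0})"
      using True by (auto simp: unk)
    moreover have "off_diagonal N z \<longleftrightarrow> (\<forall>x\<in>?I. inj_on (?\<Phi> z x) {1..?N x})"
      unfolding off_diagonal_def using \<Phi>_off by (intro ball_cong) auto
    moreover have
        "(\<forall>(a, m, i)\<in>unknowns N. (\<Prod>(b, k)\<in>?I. \<Prod>j=1..N b k. z (b, k, j) powi \<lfloor>AA g \<nu> N (a, m, i) (b, k, j)\<rfloor>)
        = (- 1) powi \<lfloor>PP g \<nu> N a m + real (N a m) + 1\<rfloor>)
      \<longleftrightarrow> (\<forall>x\<in>?I. \<forall>i\<in>{1..?N x}. ?\<Phi> z x i ^ (P x + ?N x) * (\<Prod>y\<in>?I. (\<Prod>j=1..?N y. ?\<Phi> z y j) powi K x y)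
           = (- 1) ^ (P x + ?N x + 1) * (\<Prod>j=1..?N x. ?\<Phi> z x j))" (is "?L \<longleftrightarrow> ?R")
    proof
      assume L: ?L
      show ?R
      proof (intro ballI)
        fix x i assume x: "x \<in> ?I" and i: "i \<in> {1..?N x}"
        obtain a m where am: "x = (a, m)" by (cases x)
        have "(a, m, i) \<in> unknowns N" using x i by (simp add: unk am)
        then have "(\<Prod>(b, k)\<in>?I. \<Prod>j=1..N b k. z (b, k, j) powi \<lfloor>AA g \<nu> N (a, m, i) (b, k, j)\<rfloor>)
          = (- 1) powi \<lfloor>PP g \<nu> N a m + real (N a m) + 1\<rfloor>" using L by blast
        then show "?\<Phi> z x i ^ (P x + ?N x) * (\<Prod>y\<in>?I. (\<Prod>j=1..?N y. ?\<Phi> z y j) powi K x y)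
           = (- 1) ^ (P x + ?N x + 1) * (\<Prod>j=1..?N x. ?\<Phi> z x j)"
          using equation[of z a m i] True x i unfolding am by blast
      qed
    next
      assume R: ?R
      show ?L
      proof (clarify, unfold unk)
        fix a m i assume t: "(a, m) \<in> ?I \<and> i \<in> {1..?N (a, m)}"
        then show "(\<Prod>(b, k)\<in>?I. \<Prod>j=1..N b k. z (b, k, j) powi \<lfloor>AA g \<nu> N (a, m, i) (b, k, j)\<rfloor>)
          = (- 1) powi \<lfloor>PP g \<nu> N a m + real (N a m) + 1\<rfloor>"
          using equation[of z a m i] True R by blast
      qed
    qed
    ultimately show ?thesis
      unfolding off_diagonal_solutions_def string_center_solutions_def distinct_solutions_def
          by blast
  next
    case False
    then obtain a m i where t: "(a, m) \<in> ?I" "i \<in> {1..?N (a, m)}" "z (a, m, i) = 0"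
      by (auto simp: unk)
    then have "z \<notin> off_diagonal_solutions g \<nu> N"
      by (auto simp: off_diagonal_solutions_def string_center_solutions_def unk PiE_iff)
    moreover have "?\<Phi> z (a, m) i = 0" using t by simp
    then have "?\<Phi> z \<notin> distinct_solutions ?I ?N P K"
      using t(1,2) unfolding distinct_solutions_def PiE_iff by blast
    ultimately show ?thesis by blast
  qed
  have \<Phi>\<Psi>: "?\<Phi> (?\<Psi> Z) = Z" if "Z \<in> distinct_solutions ?I ?N P K" for Z
  proof -
    have "Z x i = undefined" if "x \<in> ?I" "i \<notin> {1..?N x}" for x i
      using \<open>Z \<in> _\<close> that unfolding distinct_solutions_def PiE_iff extensional_def by blast
    moreover have "Z x = undefined" if "x \<notin> ?I" for x
      using \<open>Z \<in> _\<close> that unfolding distinct_solutions_def PiE_iff extensional_def by blast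
    ultimately show ?thesis
      by (intro ext) (auto simp: restrict_def unk)
  qed
  have \<Psi>\<Phi>: "?\<Psi> (?\<Phi> z) = z" if "z \<in> extensional (unknowns N)" for z
    using that by (intro ext) (auto simp: restrict_def unk extensional_def)
  show ?thesis
  proof (rule bij_betw_byWitness[where f' = ?\<Psi>])
    show "\<forall>z\<in>off_diagonal_solutions g \<nu> N. ?\<Psi> (?\<Phi> z) = z"
      using \<Psi>\<Phi> by (auto simp: off_diagonal_solutions_def string_center_solutions_def PiE_iff)
    show "\<forall>Z\<in>distinct_solutions ?I ?N P K. ?\<Phi> (?\<Psi> Z) = Z"
      using \<Phi>\<Psi> by blast
    show "?\<Phi> ` off_diagonal_solutions g \<nu> N \<subseteq> distinct_solutions ?I ?N P K"
      using equiv by (auto simp: off_diagonal_solutions_def string_center_solutions_def PiE_iff)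
    show "?\<Psi> ` distinct_solutions ?I ?N P K \<subseteq> off_diagonal_solutions g \<nu> N"
    proof safe
      fix Z assume Z: "Z \<in> distinct_solutions ?I ?N P K"
      have "?\<Psi> Z \<in> extensional (unknowns N)" by (rule restrict_extensional)
      from equiv[OF this] show "?\<Psi> Z \<in> off_diagonal_solutions g \<nu> N"
        unfolding \<Phi>\<Psi>[OF Z] using Z by blast
    qed
  qed
qed

text \<open>The counting theorem for any matrix \<open>g\<close> with the three properties of a Gram matrix of simple
  roots.\<close>

lemma off_diagonal_count:
  fixes g :: "nat \<Rightarrow> nat \<Rightarrow> real"
  assumes sym: "\<And>a b. g a b = g b a"
    and int: "\<And>a b. a \<in> {1..n} \<Longrightarrow> b \<in> {1..n} \<Longrightarrow> \<exists>j::int. 2 * g a b = of_int j * g b b"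
    and pd: "\<And>v :: nat \<Rightarrow> real. \<exists>a\<in>{1..n}. v a \<noteq> 0 \<Longrightarrow> (\<Sum>a=1..n. \<Sum>b=1..n. v a * v b * g a b) > 0"
    and N: "N \<in> families n"
    and P0: "\<forall>(a, m)\<in>supp N. PP g \<nu> N a m \<ge> 0"
  shows "finite (off_diagonal_solutions g \<nu> N)
    \<and> real (card (off_diagonal_solutions g \<nu> N)) / (\<Prod>(a, m)\<in>supp N. fact (N a m)) = RR g \<nu> N"
proof -
  let ?I = "supp N" and ?N = "case_prod N"
  have fin: "finite ?I" using N by (simp add: families_def supp_def)
  have in_I: "a \<in> {1..n} \<and> m \<ge> 1" if "(a, m) \<in> ?I" for a m
    using N that by (auto simp: families_def supp_def)
  have N1: "?N x \<ge> 1" if "x \<in> ?I" for x using that by (auto simp: supp_def)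
  have gpos: "g a a > 0" if a: "a \<in> {1..n}" for a
  proof -
    have "(\<Sum>c=1..n. \<Sum>b=1..n. (if c = a then 1 else 0) * (if b = a then 1 else 0) * g c b) > 0"
      using a by (intro pd bexI[of _ a]) auto
    also have "(\<Sum>c=1..n. \<Sum>b=1..n. (if c = a then 1 else 0) * (if b = a then 1 else 0) * g c b)
      = (\<Sum>c=1..n. (if c = a then 1 else 0) * (\<Sum>b=1..n. (if b = a then 1 else 0) * g c b))"
      by (simp only: mult.assoc sum_distrib_left)
    also have "\<dots> = g a a"
    proof -
      have delta: "(if Q then 1 else 0) * x = (if Q then x else 0)" for Q and x :: real by simp
      show ?thesis using a by (simp only: delta) simp
    qed
    finally show ?thesis .
  qed
  have K_int: "kernel g x y \<in> \<int>" if "x \<in> ?I" "y \<in> ?I" for x y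
  proof -
    obtain a m b k where xy: "x = (a, m)" "y = (b, k)" by (cases x, cases y)
    have ab: "a \<in> {1..n}" "b \<in> {1..n}" using that in_I unfolding xy by blast+
    show ?thesis
      unfolding xy by (rule kernel_integral[OF gpos gpos sym int int]) (use ab in auto)
  qed
  define K where "K x y = \<lfloor>kernel g x y\<rfloor>" for x y
  have K: "kernel g x y = of_int (K x y)" if "x \<in> ?I" "y \<in> ?I" for x y
    using K_int[OF that] by (auto simp: K_def elim: Ints_cases)
  define P where "P = (\<lambda>(a, m). nat \<lfloor>PP g \<nu> N a m\<rfloor>)"
  have P: "PP g \<nu> N a m = real (P (a, m))" if am: "(a, m) \<in> ?I" for a m
  proof -
    have "PP g \<nu> N a m \<in> \<int>"
      unfolding PP_def using K_int[OF am] by (intro Ints_diff Ints_sum) (auto intro!: Ints_mult)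
    moreover have "PP g \<nu> N a m \<ge> 0" using P0 am by auto
    ultimately show ?thesis by (auto simp: P_def elim!: Ints_cases)
  qed
  \<comment> \<open>\<open>F\<close> with its columns divided by the \<open>N\<^sub>x\<close>: the kernel plus a nonnegative diagonal.\<close>
  define G where "G x y = (if x = y then real (P x) / real (?N x) else 0) + kernel g x y" for x y
  have FF: "FF g \<nu> N x y = G x y * real (?N y)" if "x \<in> ?I" "y \<in> ?I" for x y
    using that N1[OF that(2)] P by (cases x; cases y) (auto simp: FF_def G_def field_simps)
  have "set_det ?I G > 0"
  proof (rule set_det_pos[OF fin])
    fix s :: "nat \<times> nat \<Rightarrow> real" assume s: "\<exists>x\<in>?I. s x \<noteq> 0"
    have "(\<Sum>x\<in>?I. \<Sum>y\<in>?I. s x * kernel g x y * s y) > 0"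
      using kernel_pos_def[of "{1..n}" g ?I s, OF _ gpos pd fin in_I s] by (simp add: mult_ac)
    moreover have "(\<Sum>x\<in>?I. \<Sum>y\<in>?I. s x * (if x = y then real (P x) / real (?N x) else 0) * s y) \<ge> 0"
      by (intro sum_nonneg) (auto simp: zero_le_mult_iff mult_le_0_iff)
    ultimately show "(\<Sum>x\<in>?I. \<Sum>y\<in>?I. s x * G x y * s y) > 0"
      by (simp add: G_def distrib_left distrib_right sum.distrib)
  qed
  moreover have "set_det ?I (FF g \<nu> N) = set_det ?I (\<lambda>x y. G x y * real (?N y))"
    unfolding set_det_def
    by (intro sum.cong prod.cong arg_cong2[where f = "(*)"] refl FF) (auto dest: permutes_in_image)
  moreover have "(\<Prod>x\<in>?I. real (?N x)) > 0"
    using N1 by (intro prod_pos) force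
  ultimately have det: "set_det ?I (FF g \<nu> N) > 0"
    by (simp add: set_det_scale_columns[OF fin])
  have FF_int: "FF g \<nu> N x y = real_of_int ((if x = y then int (P x) else 0) + K x y * int (?N y))"
    if "x \<in> ?I" "y \<in> ?I" for x y
    using that P K[OF that] by (cases x; cases y) (auto simp: FF_def)
  let ?D = "distinct_solutions ?I ?N P K"
  have count: "finite ?D" "real (card ?D) = set_det ?I (FF g \<nu> N)
      * (\<Prod>x\<in>?I. fact (?N x - 1) * (real (P x + ?N x - 1) gchoose (?N x - 1)))"
    using card_distinct_solutions[of ?I ?N "FF g \<nu> N" P K, OF fin N1 FF_int] det by auto
  note bij = off_diagonal_solutions_bij[of N g \<nu> P K, OF fin P K]
  have "finite (off_diagonal_solutions g \<nu> N)"
    using bij_betw_finite[OF bij] count(1) by simp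
  moreover have "real (card (off_diagonal_solutions g \<nu> N)) / (\<Prod>(a, m)\<in>?I. fact (N a m)) = RR g \<nu> N"
  proof -
    have "real (card (off_diagonal_solutions g \<nu> N)) / (\<Prod>(a, m)\<in>?I. fact (N a m))
      = set_det ?I (FF g \<nu> N)
        * ((\<Prod>x\<in>?I. fact (?N x - 1) * (real (P x + ?N x - 1) gchoose (?N x - 1)))
            / (\<Prod>x\<in>?I. fact (?N x)))"
      using count(2) bij_betw_same_card[OF bij] by (simp add: case_prod_beta)
    also have "(\<Prod>x\<in>?I. fact (?N x - 1) * (real (P x + ?N x - 1) gchoose (?N x - 1)))
        / (\<Prod>x\<in>?I. fact (?N x))
      = (\<Prod>(a, m)\<in>?I. 1 / real (N a m) * ((PP g \<nu> N a m + real (N a m) - 1) gchoose (N a m - 1)))"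
      unfolding prod_dividef[symmetric]
    proof (rule prod.cong[OF refl])
      fix x assume x: "x \<in> ?I"
      obtain a m where x_eq: "x = (a, m)" by (cases x)
      have am: "(a, m) \<in> ?I" using x by (simp add: x_eq)
      have n1: "N a m \<ge> 1" using N1[OF am] by simp
      have "fact (N a m) = real (N a m) * fact (N a m - 1)"
        using n1 by (simp add: fact_reduce)
      moreover have "real (P (a, m) + N a m - 1) = PP g \<nu> N a m + real (N a m) - 1"
        using n1 P[OF am] by (simp add: of_nat_diff)
      ultimately show "fact (?N x - 1) * (real (P x + ?N x - 1) gchoose (?N x - 1)) / fact (?N x)
        = (case x of (a, m) \<Rightarrow> 1 / real (N a m) * ((PP g \<nu> N a m
            + real (N a m) - 1) gchoose (N a m - 1)))"
        by (simp add: x_eq)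
    qed
    finally show ?thesis by (simp add: RR_def)
  qed
  ultimately show ?thesis by blast
qed

theorem theorem3p2:
  fixes scale :: "complex \<Rightarrow> 'g::ab_group_add \<Rightarrow> 'g"
    and br :: "'g \<Rightarrow> 'g \<Rightarrow> 'g"
    and \<h> :: "'g set"
    and B :: "'g \<Rightarrow> 'g \<Rightarrow> complex"
    and n :: nat
    and \<alpha> :: "nat \<Rightarrow> 'g \<Rightarrow> complex"
    and \<nu> N :: "nat \<Rightarrow> nat \<Rightarrow> nat"
  assumes "based_simple_lie_algebra scale br \<h> B n \<alpha>"
    and "\<nu> \<in> families n"
    and "N \<in> families n"
    and "N \<noteq> (\<lambda>_ _. 0)"
    and "\<forall>(a, m)\<in>supp N. PP (root_gram \<h> B \<alpha>) \<nu> N a m \<ge> 0"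
  shows "finite (off_diagonal_solutions (root_gram \<h> B \<alpha>) \<nu> N)
    \<and> real (card (off_diagonal_solutions (root_gram \<h> B \<alpha>) \<nu> N))
        / (\<Prod>(a, m)\<in>supp N. fact (N a m))
      = RR (root_gram \<h> B \<alpha>) \<nu> N"
proof -
  interpret based_simple_lie_algebra scale br \<h> B n \<alpha> by fact
  have int: "\<exists>j::int. 2 * root_gram \<h> B \<alpha> a b = of_int j * root_gram \<h> B \<alpha> b b"
    if "a \<in> {1..n}" "b \<in> {1..n}" for a b
    using root_gram_integral that .
  have pos: "(\<Sum>a=1..n. \<Sum>b=1..n. v a * v b * root_gram \<h> B \<alpha> a b) > 0"
    if "\<exists>a\<in>{1..n}. v a \<noteq> 0" for v :: "nat \<Rightarrow> real"
    using root_gram_pos_def that .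
  show ?thesis
    using off_diagonal_count[OF root_gram_sym int pos assms(3,5)] .
qed

end
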